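(* Let $x,y,\nu,p\in\mathbb{C}$ with $\Re(p)>0$. Then the following three integral representations hold: $$B_{\nu}(x,y;p)= 2\sqrt{\frac{2p}{\pi}}\int_0^{\pi/2} \cos^{2(x-1)}\theta\, \sin^{2(y-1)}\theta\; K_{\nu+\frac{1}{2}}\left(p\,\sec^2\theta\,\csc^2 \theta\right)d\theta,$$ $$B_{\nu}(x,y;p)=\sqrt{\frac{2p}{\pi}}\int_0^\infty \frac{u^{x-\frac{3}{2}}}{(1+u)^{x+y-1}}\, K_{\nu+\frac{1}{2}}\left(p\left(2+u+\frac{1}{u}\right)\right)du,$$ and $$B_{\nu}(x,y;p)= 2^{2-x-y}\sqrt{\frac{2p}{\pi}} \int_{-1}^1 (1+u)^{x-\frac{3}{2}}(1-u)^{y-\frac{3}{2}} K_{\nu+\frac{1}{2}}\left(\frac{4p}{1-u^2}\right)du.$$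
   Context: $K_\mu(z)$ denotes the modified Bessel function of the second kind (Macdonald function) of order $\mu$. For $x,y,\nu\in\mathbb{C}$ and $\Re(p)>0$ the extended Beta function is $$B_{\nu}(x,y;p):= \sqrt{\frac{2p}{\pi}}\int_{0}^{1} t^{x-\frac{3}{2}}(1-t)^{y-\frac{3}{2}}\, K_{\nu+\frac{1}{2}}\left(\frac{p}{t(1-t)}\right)dt .$$ Powers and square roots take principal values. *)

theory Defs
  imports "HOL-Analysis.Analysis"
begin

definition bessel_I :: "complex \<Rightarrow> complex \<Rightarrow> complex" where
  "bessel_I \<mu> z = (z / 2) powr \<mu> * (\<Sum>k. (z\<^sup>2 / 4) ^ k * rGamma (\<mu> + of_nat k + 1) / fact k)"

text \<open>
  The Macdonald function is \<open>(\<pi> / 2) (I\<^bsub>-\<mu>\<^esub>(z) - I\<^bsub>\<mu>\<^esub>(z)) / sin (\<mu> \<pi>)\<close>. At integer orders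
  the quotient is of the form 0/0, and the value is the limit of the quotient as the order
  tends to \<open>\<mu>\<close>.
\<close>

definition bessel_K :: "complex \<Rightarrow> complex \<Rightarrow> complex" where
  "bessel_K \<mu> z =
    (let Q = (\<lambda>\<kappa>. of_real (pi / 2) * (bessel_I (- \<kappa>) z - bessel_I \<kappa> z) / sin (\<kappa> * of_real pi))
     in if \<mu> \<in> \<int> then Lim (at \<mu>) Q else Q \<mu>)"

definition ext_Beta :: "complex \<Rightarrow> complex \<Rightarrow> complex \<Rightarrow> complex \<Rightarrow> complex" where
  "ext_Beta \<nu> x y p = csqrt (2 * p / of_real pi) *
    (LBINT t=0..1. of_real t powr (x - 3/2) * of_real (1 - t) powr (y - 3/2) *
       bessel_K (\<nu> + 1/2) (p / of_real (t * (1 - t))))"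

end

theory Submission
  imports Defs "HOL-Real_Asymp.Real_Asymp"
begin

text \<open>
  The three formulas are the substitutions \<open>t = cos\<^sup>2 \<theta>\<close>, \<open>t = u / (1 + u)\<close> and \<open>t = (1 + u) / 2\<close>;
  the content lies in the convergence of the integrals for arbitrary \<open>x\<close> and \<open>y\<close>, which needs the
  decay of the Macdonald function at infinity, whereas its definition only describes it near \<open>0\<close>.

  The decay is read off from the integral representation
  \<open>2 K\<^bsub>\<mu>\<^esub>(2a) = \<integral>\<^sub>1\<^sup>\<infinity> (s\<^bsup>\<mu> - 1\<^esup> + s\<^bsup>-\<mu> - 1\<^esup>) exp (-a (s + 1/s)) ds\<close> for \<open>Re a > 0\<close>.
  For non-integer \<open>\<mu>\<close>, the reflection formula turns the difference of the two Bessel series into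
  \<open>\<Sum>\<^sub>k (-1)\<^sup>k a\<^bsup>2k\<^esup> / k! (a\<^bsup>-\<mu>\<^esup> \<Gamma>(\<mu> - k) + a\<^bsup>\<mu>\<^esup> \<Gamma>(-\<mu> - k))\<close>. Split
  \<open>\<Gamma>(w) = a\<^sup>w (\<Sum>\<^sub>n (-a)\<^sup>n / (n! (n + w)) + \<integral>\<^sub>1\<^sup>\<infinity> s\<^bsup>w - 1\<^esup> exp (-a s) ds)\<close> (Prym's decomposition).
  The integrals sum to the representation above, and the remaining double series
  \<open>\<Sum>\<^sub>k \<Sum>\<^sub>n (-a)\<^bsup>k + n\<^esup> / (k! n!) (1 / (n - k + \<mu>) + 1 / (n - k - \<mu>))\<close> vanishes because exchanging
  \<open>k\<close> and \<open>n\<close> changes its sign. Integer orders follow by continuity in \<open>\<mu>\<close>.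
\<close>

section \<open>Euler's integral with complex scale\<close>

lemma set_integrable_continuous_bound:
  fixes f :: "real \<Rightarrow> complex"
  assumes "A \<in> sets borel" "continuous_on A f" "set_integrable lborel A g"
    and "\<And>x. x \<in> A \<Longrightarrow> norm (f x) \<le> (g x :: real)"
  shows "set_integrable lborel A f"
proof (rule set_integrable_bound[OF assms(3)])
  show "set_borel_measurable lborel A f"
    using borel_measurable_continuous_on_indicator[OF assms(1,2)]
    by (simp add: set_borel_measurable_def)
  show "AE x in lborel. x \<in> A \<longrightarrow> norm (f x) \<le> norm (g x)"
    using assms(4) by force
qed

text \<open>Termwise integration under absolute convergence. The pointwise sum \<open>g\<close> is
  named, so that each expansion below only has to identify it and bound the integrals of the
  norms.\<close>

lemma set_integral_sums:
  fixes f :: "nat \<Rightarrow> real \<Rightarrow> complex"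
  assumes "\<And>i. set_integrable M A (f i)"
    and "\<And>x. x \<in> A \<Longrightarrow> summable (\<lambda>i. norm (f i x))"
    and "\<And>x. x \<in> A \<Longrightarrow> (\<lambda>i. f i x) sums g x"
    and "summable (\<lambda>i. LINT x:A|M. norm (f i x))"
  shows "set_integrable M A g"
    and "(\<lambda>i. LINT x:A|M. f i x) sums (LINT x:A|M. g x)"
proof -
  let ?f = "\<lambda>i x. indicator A x *\<^sub>R f i x"
  have eq: "(\<Sum>i. ?f i x) = indicator A x *\<^sub>R g x" for x
    using assms(3)[of x] by (cases "x \<in> A") (auto simp: sums_iff)
  have 1: "AE x in M. summable (\<lambda>i. norm (?f i x))"
    using assms(2) by (intro AE_I2) (auto simp: indicator_def)
  have 2: "summable (\<lambda>i. \<integral>x. norm (?f i x) \<partial>M)"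
    using assms(4) by (simp add: set_lebesgue_integral_def)
  have 3: "\<And>i. integrable M (?f i)"
    using assms(1) by (simp add: set_integrable_def)
  show "set_integrable M A g" "(\<lambda>i. LINT x:A|M. f i x) sums (LINT x:A|M. g x)"
    using integrable_suminf[OF 3 1 2] sums_integral[OF 3 1 2]
    by (simp_all add: eq set_integrable_def set_lebesgue_integral_def)
qed

text \<open>Integrand of Euler's integral with scale \<open>a\<close>; it is later integrated over
  the whole half-line, over \<open>{0<..1}\<close> and over \<open>{1<..}\<close>.\<close>

definition gamma_kernel :: "complex \<Rightarrow> complex \<Rightarrow> real \<Rightarrow> complex" where
  "gamma_kernel w a s = of_real s powr (w - 1) * exp (- a * of_real s)"

lemma norm_gamma_kernel:
  "s > 0 \<Longrightarrow> norm (gamma_kernel w a s) = s powr (Re w - 1) * exp (- Re a * s)"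
  by (simp add: gamma_kernel_def norm_mult norm_powr_real_powr)

lemma continuous_on_gamma_kernel [continuous_intros]:
  "A \<subseteq> {0<..} \<Longrightarrow> continuous_on A (gamma_kernel w a)"
  unfolding gamma_kernel_def by (intro continuous_intros) (auto simp: complex_nonpos_Reals_iff)

text \<open>For \<open>b = 1\<close> this is Euler's integral; other positive scales follow from the
  substitution of \<open>b * s\<close> for \<open>s\<close>.\<close>

lemma gamma_kernel_real_integral:
  assumes "Re w > 0" "b > 0"
  shows "set_integrable lborel {0<..} (gamma_kernel w (of_real b))"
    and "(LBINT s:{0<..}. gamma_kernel w (of_real b) s) = Gamma w * of_real b powr (-w)"
proof -
  let ?f = "\<lambda>s. indicator {0<..} s *\<^sub>R gamma_kernel w 1 s"
  have eq: "gamma_kernel w 1 = (\<lambda>t. of_real t powr (w - 1) / of_real (exp t))"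
    by (auto simp: gamma_kernel_def exp_minus field_simps exp_of_real)
  have [measurable]: "?f \<in> borel_measurable borel"
    by (intro borel_measurable_continuous_on_indicator continuous_intros) auto
  have "integrable lebesgue ?f"
    using absolutely_integrable_Gamma_integral'[OF assms(1)]
    by (simp add: eq set_integrable_def)
  hence int: "integrable lborel ?f"
    by (subst (asm) integrable_completion) auto
  have "integral\<^sup>L lborel ?f = Gamma w"
    using Gamma_integral_complex'[OF assms(1)] set_borel_integral_eq_integral(2)[of "{0<..}" "gamma_kernel w 1"] int
    by (simp add: set_integrable_def set_lebesgue_integral_def integral_unique eq)
  with int have "has_bochner_integral lborel ?f (Gamma w)"
    by (simp add: has_bochner_integral_iff)
  hence "has_bochner_integral lborel (\<lambda>s. ?f (0 + b * s)) (Gamma w /\<^sub>R \<bar>b\<bar>)"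
    using assms by (subst (asm) lborel_has_bochner_integral_real_affine_iff[of b _ _ 0]) auto
  \<comment> \<open>The factor cancels the power \<open>b powr (w - 1)\<close> that arises when the
    kernel is evaluated at \<open>b * s\<close>.\<close>
  hence "has_bochner_integral lborel (\<lambda>s. of_real b powr (1 - w) * ?f (0 + b * s))
      (of_real b powr (1 - w) * (Gamma w /\<^sub>R \<bar>b\<bar>))"
    by (rule has_bochner_integral_mult_right)
  also have "(\<lambda>s. of_real b powr (1 - w) * ?f (0 + b * s))
      = (\<lambda>s. indicator {0<..} s *\<^sub>R gamma_kernel w (of_real b) s)"
  proof
    fix s :: real
    show "of_real b powr (1 - w) * ?f (0 + b * s) = indicator {0<..} s *\<^sub>R gamma_kernel w (of_real b) s"
    proof (cases "s > 0")
      case True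
      have "complex_of_real b powr (1 - w) * of_real b powr (w - 1) = 1"
        using assms by (simp flip: powr_add)
      thus ?thesis using True assms
        by (simp add: gamma_kernel_def powr_times_real zero_less_mult_iff)
    qed (use assms in \<open>auto simp: zero_less_mult_iff\<close>)
  qed
  also have "of_real b powr (1 - w) * (Gamma w /\<^sub>R \<bar>b\<bar>) = Gamma w * of_real b powr (-w)"
  proof -
    have "complex_of_real b powr (1 - w) = of_real b * of_real b powr (-w)"
      using assms powr_add[of "complex_of_real b" 1 "-w"] by simp
    thus ?thesis using assms by (simp add: scaleR_conv_of_real)
  qed
  finally show "set_integrable lborel {0<..} (gamma_kernel w (of_real b))"
    and "(LBINT s:{0<..}. gamma_kernel w (of_real b) s) = Gamma w * of_real b powr (-w)"
    by (simp_all add: has_bochner_integral_iff set_integrable_def set_lebesgue_integral_def)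
qed

lemma gamma_kernel_integrable:
  assumes "Re w > 0" "Re a > 0"
  shows "set_integrable lborel {0<..} (gamma_kernel w a)"
proof (rule set_integrable_continuous_bound)
  show "set_integrable lborel {0<..} (\<lambda>s. norm (gamma_kernel w (of_real (Re a)) s))"
    using gamma_kernel_real_integral(1)[OF assms] by (rule set_integrable_norm)
qed (auto simp: norm_gamma_kernel intro!: continuous_intros)

text \<open>Binomial series of \<open>(1 - d / b) powr (-w)\<close> times
  \<open>Gamma w * b powr (-w)\<close>. As \<open>Gamma (w + n) = pochhammer w n * Gamma w\<close>,
  the terms are those obtained by expanding \<open>exp (d * s)\<close> under Euler's integral of
  scale \<open>b\<close>.\<close>

lemma gamma_series_sums:
  fixes w d :: complex and b :: real
  assumes "norm d < b" "w \<notin> \<int>\<^sub>\<le>\<^sub>0"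
  shows "(\<lambda>n. d ^ n / fact n * (Gamma (w + of_nat n) * of_real b powr (- (w + of_nat n)))) sums
    (Gamma w * (of_real b - d) powr (-w))"
proof -
  have b: "b > 0" using assms norm_ge_zero[of d] by linarith
  have "(\<lambda>n. (-w gchoose n) * (- d / of_real b) ^ n) sums (1 + (- d / of_real b)) powr (-w)"
    using assms b by (intro gen_binomial_complex) (simp add: norm_divide)
  hence "(\<lambda>n. Gamma w * of_real b powr (-w) * ((-w gchoose n) * (- d / of_real b) ^ n)) sums
     (Gamma w * of_real b powr (-w) * (1 + (- d / of_real b)) powr (-w))"
    by (rule sums_mult)
  also have "Gamma w * of_real b powr (-w) * (1 + (- d / of_real b)) powr (-w) = Gamma w * (of_real b - d) powr (-w)"
  proof -
    have "(of_real b * (1 + (- d / of_real b))) powr (-w) = of_real b powr (-w) * (1 + (- d / of_real b)) powr (-w)"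
      using b by (intro powr_times_real_left) auto
    moreover have "complex_of_real b * (1 + (- d / of_real b)) = of_real b - d"
      using b by (simp add: field_simps)
    ultimately show ?thesis by simp
  qed
  also have "(\<lambda>n. Gamma w * of_real b powr (-w) * ((-w gchoose n) * (- d / of_real b) ^ n)) =
     (\<lambda>n. d ^ n / fact n * (Gamma (w + of_nat n) * of_real b powr (- (w + of_nat n))))"
  proof
    fix n
    have "Gamma (w + of_nat n) = pochhammer w n * Gamma w"
      using assms(2) by (simp add: pochhammer_Gamma Gamma_eq_zero_iff)
    moreover have "complex_of_real b powr (- (w + of_nat n)) = of_real b powr (-w) / of_real b ^ n"
      using b by (simp add: powr_diff powr_nat')
    moreover have "(-w gchoose n) = (-1)^n * pochhammer w n / fact n"
      by (simp add: gbinomial_pochhammer)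
    moreover have "(- d / of_real b) ^ n = (-1)^n * d^n / of_real b ^ n"
      by (simp add: power_minus[of "d / of_real b"] power_divide)
    ultimately show "Gamma w * of_real b powr (-w) * ((-w gchoose n) * (- d / of_real b) ^ n) =
      d ^ n / fact n * (Gamma (w + of_nat n) * of_real b powr (- (w + of_nat n)))"
      by (simp add: power_mult_distrib[symmetric])
  qed
  finally show ?thesis .
qed

lemma gamma_kernel_integral:
  assumes w: "Re w > 0" and a: "Re a > 0"
  shows "(LBINT s:{0<..}. gamma_kernel w a s) = Gamma w * a powr (-w)"
proof -
  have nz: "v \<notin> \<int>\<^sub>\<le>\<^sub>0" if "Re v > 0" for v using that by (auto elim!: nonpos_Ints_cases)
  txt \<open>The binomial series of \<open>(b - d) powr (-w)\<close>, for a real \<open>b\<close> so large that \<open>a\<close> lies in the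
    disc of radius \<open>b\<close> around \<open>b\<close>, extends the formula from real to complex scale.\<close>
  define b where "b = (norm a)\<^sup>2 / Re a"
  have "(Re a)\<^sup>2 > 0" using a by simp
  hence na: "(norm a)\<^sup>2 > 0" using a by (auto simp: cmod_power2 intro: add_pos_nonneg)
  have b: "b > 0" using a na by (simp add: b_def)
  define d where "d = of_real b - a"
  \<comment> \<open>The choice of \<open>b\<close> makes \<open>b * Re a\<close> the squared norm of
    \<open>a\<close>, so the squared norm of \<open>d\<close> is \<open>b\<close> squared minus that
    of \<open>a\<close>.\<close>
  have "(norm d)\<^sup>2 = b\<^sup>2 - 2 * b * Re a + (norm a)\<^sup>2"
    unfolding d_def cmod_power2 by (simp add: power2_eq_square algebra_simps)
  also have "2 * b * Re a = 2 * (norm a)\<^sup>2" using a by (simp add: b_def)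
  also have "b\<^sup>2 - 2 * (norm a)\<^sup>2 + (norm a)\<^sup>2 < b\<^sup>2" using na by simp
  finally have d: "norm d < b" using b by (simp add: power2_less_imp_less)
  \<comment> \<open>Since \<open>a = b - d\<close>, the kernel at \<open>a\<close> is the kernel at
    \<open>b\<close> times \<open>exp (d * s)\<close>, here expanded.\<close>
  let ?g = "\<lambda>n s. d ^ n / fact n * gamma_kernel (w + of_nat n) (of_real b) s"
  have g: "?g n s = gamma_kernel w (of_real b) s * ((d * of_real s) ^ n /\<^sub>R fact n)" if "s > 0" for n s
  proof -
    have "complex_of_real s powr (w + of_nat n - 1) = of_real s powr (w - 1) * of_real s ^ n"
      using that powr_add[of "complex_of_real s" "w - 1" "of_nat n"] by (simp add: powr_nat' algebra_simps)
    thus ?thesis by (simp add: gamma_kernel_def scaleR_conv_of_real power_mult_distrib field_simps)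
  qed
  have ints: "(LBINT s:{0<..}. ?g n s) = d ^ n / fact n * (Gamma (w + of_nat n) * of_real b powr (- (w + of_nat n)))" for n
    using gamma_kernel_real_integral(2)[of "w + of_nat n" b] w b by simp
  have "(\<lambda>n. LBINT s:{0<..}. ?g n s) sums (LBINT s:{0<..}. gamma_kernel w a s)"
  proof (rule set_integral_sums)
    fix n
    show "set_integrable lborel {0<..} (?g n)"
      using gamma_kernel_real_integral(1)[of "w + of_nat n" b] w b
      by (intro set_integrable_mult_right) auto
  next
    fix s :: real assume s: "s \<in> {0<..}"
    have "summable (\<lambda>n. norm (gamma_kernel w (of_real b) s) * (norm ((d * of_real s) ^ n /\<^sub>R fact n)))"
      by (intro summable_mult summable_norm_exp)
    thus "summable (\<lambda>n. norm (?g n s))" 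
      using s by (simp only: g norm_mult greaterThan_iff)
    have "(\<lambda>n. gamma_kernel w (of_real b) s * ((d * of_real s) ^ n /\<^sub>R fact n)) sums
       (gamma_kernel w (of_real b) s * exp (d * of_real s))"
      by (intro sums_mult exp_converges)
    also have "gamma_kernel w (of_real b) s * exp (d * of_real s) = gamma_kernel w a s"
      by (simp add: gamma_kernel_def d_def algebra_simps flip: exp_add)
    finally show "(\<lambda>n. ?g n s) sums gamma_kernel w a s"
      using s by (simp only: g greaterThan_iff)
  next
    \<comment> \<open>Norms replace \<open>w\<close> by \<open>Re w\<close> and \<open>d\<close> by
      \<open>norm d\<close>, so summability is another instance of
      \<open>gamma_series_sums\<close>.\<close>
    have "(LBINT s:{0<..}. norm (?g n s)) = norm d ^ n / fact n * (Gamma (Re w + of_nat n) * b powr (- (Re w + of_nat n)))" for n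
    proof -
      have 1: "complex_of_real (norm (gamma_kernel (w + of_nat n) (of_real b) s)) = gamma_kernel (of_real (Re w) + of_nat n) (of_real b) s" if "s > 0" for s
        using that powr_of_real[of s "Re w + of_nat n - 1"]
        by (simp add: norm_gamma_kernel, simp add: gamma_kernel_def flip: exp_of_real)
      have 2: "complex_of_real (LBINT s:{0<..}. norm (?g n s)) = norm d ^ n / fact n * (LBINT s:{0<..}. gamma_kernel (of_real (Re w) + of_nat n) (of_real b) s)"
        unfolding set_integral_complex_of_real[symmetric] set_integral_mult_right[symmetric]
        by (rule set_lebesgue_integral_cong) (auto simp: norm_mult norm_divide norm_power 1)
      also have "\<dots> = complex_of_real (norm d ^ n / fact n * (Gamma (Re w + of_nat n) * b powr (- (Re w + of_nat n))))"
        using gamma_kernel_real_integral(2)[of "of_real (Re w) + of_nat n" b] w b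
           Gamma_complex_of_real[of "Re w + of_nat n"] powr_of_real[of b "-(Re w + of_nat n)"]
        by simp
      finally show ?thesis using of_real_eq_iff by blast
    qed
    moreover have "summable (\<lambda>n. norm d ^ n / fact n * (Gamma (Re w + of_nat n) * b powr (- (Re w + of_nat n))))"
    proof -
      have "summable (\<lambda>n. complex_of_real (norm d ^ n / fact n * (Gamma (Re w + of_nat n) * b powr (- (Re w + of_nat n)))))"
        using gamma_series_sums[of "of_real (norm d)" b "of_real (Re w)", THEN sums_summable] d nz[of "of_real (Re w)"] w b
           Gamma_complex_of_real[of "Re w + of_nat n" for n] powr_of_real[of b "-(Re w + of_nat n)" for n]
        by simp
      thus ?thesis by (simp only: summable_complex_of_real)
    qed
    ultimately show "summable (\<lambda>n. LBINT s:{0<..}. norm (?g n s))" by simp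
  qed
  moreover have "(\<lambda>n. LBINT s:{0<..}. ?g n s) sums (Gamma w * (of_real b - d) powr (-w))"
    unfolding ints using gamma_series_sums[OF d nz[OF w]] .
  ultimately show ?thesis by (simp add: sums_unique2 d_def)
qed

section \<open>The part of Euler's integral over s > 1\<close>

lemma gamma_kernel_integrable_gt_1:
  assumes "Re a > 0"
  shows "set_integrable lborel {1<..} (gamma_kernel w a)"
proof (rule set_integrable_continuous_bound)
  \<comment> \<open>For \<open>s > 1\<close> a larger exponent only enlarges the power of
    \<open>s\<close>; with a positive exponent Euler's integral is a majorant, whatever
    \<open>w\<close> is.\<close>
  define v where "v = complex_of_real (max 1 (Re w))"
  have "set_integrable lborel {0<..} (\<lambda>s. norm (gamma_kernel v a s))"
    by (intro set_integrable_norm gamma_kernel_integrable assms) (simp add: v_def)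
  thus "set_integrable lborel {1<..} (\<lambda>s. norm (gamma_kernel v a s))"
    by (rule set_integrable_subset) auto
  show "norm (gamma_kernel w a s) \<le> norm (gamma_kernel v a s)" if "s \<in> {1<..}" for s
    using that by (auto simp: norm_gamma_kernel v_def intro!: powr_mono)
qed (auto intro!: continuous_intros)

lemma has_vector_derivative_gamma_kernel:
  assumes "s > 0"
  shows "(gamma_kernel (w + 1) a has_vector_derivative
    w * gamma_kernel w a s - a * gamma_kernel (w + 1) a s) (at s)"
proof -
  have s: "complex_of_real s \<notin> \<real>\<^sub>\<le>\<^sub>0" using assms by (auto simp: complex_nonpos_Reals_iff)
  have "((\<lambda>s. s powr w * exp (- a * s)) has_field_derivative
       w * (of_real s powr (w - 1) * exp (- a * of_real s)) - a * (of_real s powr w * exp (- a * of_real s))) (at (of_real s))"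
    using s by (auto intro!: derivative_eq_intros simp: algebra_simps)
  from has_vector_derivative_real_field[OF this] show ?thesis
    by (simp add: gamma_kernel_def[abs_def] o_def)
qed

lemma gamma_kernel_tendsto_0:
  assumes "Re a > 0"
  shows "(gamma_kernel w a \<longlongrightarrow> 0) at_top"
proof (rule tendsto_norm_zero_cancel)
  have "((\<lambda>s. s powr (Re w - 1) * exp (- Re a * s)) \<longlongrightarrow> 0) at_top"
    using assms by real_asymp
  moreover have "\<forall>\<^sub>F s in at_top. s powr (Re w - 1) * exp (- Re a * s) = norm (gamma_kernel w a s)"
    using eventually_gt_at_top[of 0] by eventually_elim (simp add: norm_gamma_kernel)
  ultimately show "((\<lambda>s. norm (gamma_kernel w a s)) \<longlongrightarrow> 0) at_top"
    by (rule Lim_transform_eventually)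
qed

text \<open>For \<open>Re a > 0\<close> this is the upper incomplete Gamma function at
  \<open>(w, a)\<close> divided by \<open>a powr w\<close>.\<close>

definition upper_gamma :: "complex \<Rightarrow> complex \<Rightarrow> complex" where
  "upper_gamma w a = (LBINT s:{1<..}. gamma_kernel w a s)"

text \<open>Integration by parts, as the fundamental theorem for
  \<open>gamma_kernel (w + 1) a\<close>, which is \<open>exp (-a)\<close> at 1 and vanishes at
  infinity.\<close>

lemma upper_gamma_rec:
  assumes "Re a > 0"
  shows "a * upper_gamma (w + 1) a = exp (-a) + w * upper_gamma w a"
proof -
  let ?f = "\<lambda>s. w * gamma_kernel w a s - a * gamma_kernel (w + 1) a s"
  have int: "set_integrable lborel {1<..} ?f"
    using assms by (intro set_integral_diff set_integrable_mult_right gamma_kernel_integrable_gt_1)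
  have einterval: "einterval 1 \<infinity> = {1<..}"
    by (auto simp: einterval_def one_ereal_def)
  have "(LBINT s=1..\<infinity>. ?f s) = 0 - exp (-a)"
  proof (rule interval_integral_FTC_integrable)
    fix s assume "1 < ereal s"
    hence s: "s > 0" by (simp add: one_ereal_def)
    show "(gamma_kernel (w + 1) a has_vector_derivative ?f s) (at s)"
      by (rule has_vector_derivative_gamma_kernel[OF s])
    have "continuous_on {0<..} ?f" by (intro continuous_intros) auto
    thus "isCont ?f s" using s by (auto simp: continuous_on_eq_continuous_at)
  next
    show "set_integrable lborel (einterval 1 \<infinity>) ?f"
      using int by (simp add: einterval)
  next
    have "continuous_on {0<..} (gamma_kernel (w + 1) a)" by (intro continuous_intros) auto
    hence "isCont (gamma_kernel (w + 1) a) 1" by (auto simp: continuous_on_eq_continuous_at)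
    hence "(gamma_kernel (w + 1) a \<longlongrightarrow> gamma_kernel (w + 1) a 1) (at_right 1)"
      by (simp add: isCont_def filterlim_at_split)
    thus "((gamma_kernel (w + 1) a \<circ> real_of_ereal) \<longlongrightarrow> exp (-a)) (at_right 1)"
      by (simp add: one_ereal_def ereal_tendsto_simps gamma_kernel_def)
    show "((gamma_kernel (w + 1) a \<circ> real_of_ereal) \<longlongrightarrow> 0) (at_left \<infinity>)"
      using gamma_kernel_tendsto_0[OF assms] by (simp add: ereal_tendsto_simps)
  qed auto
  also have "(LBINT s=1..\<infinity>. ?f s) = (LBINT s:{1<..}. ?f s)"
    by (simp add: interval_lebesgue_integral_def einterval)
  also have "\<dots> = w * upper_gamma w a - a * upper_gamma (w + 1) a"
    using assms unfolding upper_gamma_def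
    by (subst set_integral_diff) (auto intro!: set_integrable_mult_right gamma_kernel_integrable_gt_1)
  finally show ?thesis by (simp add: algebra_simps)
qed

section \<open>Prym's decomposition of the Gamma function\<close>

lemma powr_integral_0_1:
  fixes v :: complex
  assumes "Re v > 0"
  shows "set_integrable lborel {0<..1} (\<lambda>s. complex_of_real s powr (v - 1))"
    and "(LBINT s:{0<..1}. complex_of_real s powr (v - 1)) = 1 / v"
proof -
  have v: "v \<noteq> 0" using assms by auto
  show int: "set_integrable lborel {0<..1} (\<lambda>s. complex_of_real s powr (v - 1))"
  proof (rule set_integrable_continuous_bound)
    \<comment> \<open>On \<open>{0<..1}\<close> the factor \<open>exp (1 - s)\<close> is at least 1,
      so \<open>exp 1\<close> times the Gamma kernel of scale 1 majorises the bare power.\<close>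
    have "set_integrable lborel {0<..} (\<lambda>s. exp 1 * norm (gamma_kernel v 1 s))"
      by (intro set_integrable_mult_right set_integrable_norm gamma_kernel_integrable assms) auto
    thus "set_integrable lborel {0<..1} (\<lambda>s. exp 1 * norm (gamma_kernel v 1 s))"
      by (rule set_integrable_subset) auto
    fix s :: real assume s: "s \<in> {0<..1}"
    have "s powr (Re v - 1) * 1 \<le> s powr (Re v - 1) * exp (1 - s)"
      using s by (intro mult_left_mono) auto
    thus "norm (complex_of_real s powr (v - 1)) \<le> exp 1 * norm (gamma_kernel v 1 s)"
      using s by (simp add: norm_gamma_kernel norm_powr_real_powr exp_diff exp_minus field_simps)
  qed (auto intro!: continuous_intros simp: complex_nonpos_Reals_iff)
  let ?F = "\<lambda>s. complex_of_real s powr v / v"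
  have deriv: "(?F has_vector_derivative complex_of_real s powr (v - 1)) (at s)" if "s > 0" for s
  proof -
    have s: "complex_of_real s \<notin> \<real>\<^sub>\<le>\<^sub>0" using that by (auto simp: complex_nonpos_Reals_iff)
    have "((\<lambda>s. s powr v / v) has_field_derivative of_real s powr (v - 1)) (at (of_real s))"
      using s v by (auto intro!: derivative_eq_intros)
    from has_vector_derivative_real_field[OF this] show ?thesis
      by (simp add: o_def)
  qed
  have "(LBINT s=0..1. complex_of_real s powr (v - 1)) = 1 / v - 0"
  proof (rule interval_integral_FTC_integrable[where F = ?F])
    fix s assume "0 < ereal s"
    hence s: "s > 0" by (simp add: zero_ereal_def)
    show "(?F has_vector_derivative complex_of_real s powr (v - 1)) (at s)"
      by (rule deriv[OF s])
    have "continuous_on {0<..} (\<lambda>s. complex_of_real s powr (v - 1))"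
      by (auto intro!: continuous_intros simp: complex_nonpos_Reals_iff)
    thus "isCont (\<lambda>s. complex_of_real s powr (v - 1)) s"
      using s by (auto simp: continuous_on_eq_continuous_at)
  next
    show "set_integrable lborel (einterval 0 1) (\<lambda>s. complex_of_real s powr (v - 1))"
      by (rule set_integrable_subset[OF int]) (auto simp: einterval_def zero_ereal_def one_ereal_def)
  next
    have "((\<lambda>s. s powr Re v / norm v) \<longlongrightarrow> 0) (at_right 0)"
      using assms v by real_asymp
    moreover have "\<forall>\<^sub>F s in at_right 0. s powr Re v / norm v = norm (?F s)"
      using eventually_at_right_less[of 0]
      by eventually_elim (simp add: norm_divide norm_powr_real_powr)
    ultimately have "((\<lambda>s. norm (?F s)) \<longlongrightarrow> 0) (at_right 0)"
      by (rule Lim_transform_eventually)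
    hence "(?F \<longlongrightarrow> 0) (at_right 0)" by (rule tendsto_norm_zero_cancel)
    thus "((?F \<circ> real_of_ereal) \<longlongrightarrow> 0) (at_right 0)"
      by (simp add: zero_ereal_def ereal_tendsto_simps)
    have "isCont ?F 1" using deriv[of 1] by (simp add: has_vector_derivative_continuous)
    hence "(?F \<longlongrightarrow> ?F 1) (at_left 1)"
      by (simp add: isCont_def filterlim_at_split)
    thus "((?F \<circ> real_of_ereal) \<longlongrightarrow> 1 / v) (at_left 1)"
      by (simp add: one_ereal_def ereal_tendsto_simps)
  qed auto
  thus "(LBINT s:{0<..1}. complex_of_real s powr (v - 1)) = 1 / v"
    using interval_integral_Ioc[of 0 1 "\<lambda>s. complex_of_real s powr (v - 1)"]
    by (simp add: zero_ereal_def one_ereal_def)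
qed

section \<open>The part over s <= 1, continued in w\<close>

lemma noninteger_separated:
  fixes w :: complex
  assumes "w \<notin> \<int>"
  obtains \<delta> where "\<delta> > 0" "\<And>m. m \<in> \<int> \<Longrightarrow> \<delta> \<le> norm (m + w)"
proof -
  have "- w \<notin> \<int>" using assms by auto
  \<comment> \<open>Closedness of the integers bounds all later denominators away from 0 at
    once.\<close>
  from separate_point_closed[OF closed_Ints this]
  obtain d where "d > 0" "\<And>m. m \<in> \<int> \<Longrightarrow> d \<le> dist (-w) m" by blast
  thus ?thesis using that[of d] by (simp add: dist_norm norm_minus_commute[of "-w"])
qed

lemma exp_term_sums:
  fixes a :: "'a::{real_normed_field,banach}"
  shows "(\<lambda>n. a ^ n / fact n) sums exp a"
  using exp_converges[of a] by (simp add: scaleR_conv_of_real field_simps)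

text \<open>Termwise integral of \<open>gamma_kernel w a\<close> over \<open>{0<..1}\<close>. The
  series still makes sense for non-integer \<open>w\<close> with \<open>Re w <= 0\<close>, where the
  integral diverges.\<close>

definition lower_gamma :: "complex \<Rightarrow> complex \<Rightarrow> complex" where
  "lower_gamma w a = (\<Sum>n. (-a) ^ n / fact n / (of_nat n + w))"

lemma lower_gamma_sums:
  assumes "w \<notin> \<int>"
  shows "summable (\<lambda>n. norm ((-a) ^ n / fact n / (of_nat n + w)))"
    and "(\<lambda>n. (-a) ^ n / fact n / (of_nat n + w)) sums lower_gamma w a"
proof -
  obtain \<delta> where \<delta>: "\<delta> > 0" "\<And>m. m \<in> \<int> \<Longrightarrow> \<delta> \<le> norm (m + w)"
    using noninteger_separated[OF assms] by blast
  show *: "summable (\<lambda>n. norm ((-a) ^ n / fact n / (of_nat n + w)))"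
  proof (rule summable_comparison_test')
    show "summable (\<lambda>n. norm a ^ n / fact n / \<delta>)"
      by (intro summable_divide sums_summable[OF exp_term_sums])
    show "norm (norm ((-a) ^ n / fact n / (of_nat n + w))) \<le> norm a ^ n / fact n / \<delta>" for n
      using \<delta>(1) \<delta>(2)[of "of_nat n"] by (auto simp: norm_divide norm_power norm_mult intro!: frac_le)
  qed
  show "(\<lambda>n. (-a) ^ n / fact n / (of_nat n + w)) sums lower_gamma w a"
    unfolding lower_gamma_def using summable_norm_cancel[OF *] by (rule summable_sums)
qed

text \<open>Write \<open>w = (n + w) - n\<close> in each term: the first part cancels the
  denominator and sums to \<open>exp (-a)\<close>, the second is the series for \<open>w + 1\<close>
  shifted by one index.\<close>

lemma lower_gamma_rec:
  assumes "w \<notin> \<int>"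
  shows "w * lower_gamma w a = exp (-a) + a * lower_gamma (w + 1) a"
proof -
  have w1: "w + 1 \<notin> \<int>" using assms Ints_diff[of "w + 1" 1] by auto
  have nz: "of_nat n + w \<noteq> 0" for n
    using assms by (metis Ints_minus Ints_of_nat add_eq_0_iff)
  let ?g = "\<lambda>n. of_nat n * ((-a) ^ n / fact n / (of_nat n + w))"
  have "(\<lambda>n. ?g (Suc n)) = (\<lambda>n. - a * ((-a) ^ n / fact n / (of_nat n + (w + 1))))"
  proof
    fix n
    show "?g (Suc n) = - a * ((-a) ^ n / fact n / (of_nat n + (w + 1)))"
      using nz[of "Suc n"] of_nat_neq_0[of n, where ?'a=complex]
      by (simp add: divide_simps del: of_nat_Suc) (simp add: algebra_simps)
  qed
  moreover have "(\<lambda>n. - a * ((-a) ^ n / fact n / (of_nat n + (w + 1)))) sums (- a * lower_gamma (w + 1) a)"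
    by (intro sums_mult lower_gamma_sums w1)
  ultimately have "(\<lambda>n. ?g (Suc n)) sums (- a * lower_gamma (w + 1) a)" by simp
  \<comment> \<open>The term of \<open>?g\<close> at \<open>n = 0\<close> vanishes, so undoing the
    shift leaves the sum unchanged.\<close>
  hence "?g sums (- a * lower_gamma (w + 1) a)" by (subst (asm) sums_Suc_iff) simp
  hence "(\<lambda>n. ?g n + w * ((-a) ^ n / fact n / (of_nat n + w))) sums (- a * lower_gamma (w + 1) a + w * lower_gamma w a)"
    by (intro sums_add sums_mult lower_gamma_sums assms)
  also have "(\<lambda>n. ?g n + w * ((-a) ^ n / fact n / (of_nat n + w))) = (\<lambda>n. (-a) ^ n / fact n)"
  proof
    fix n
    have "?g n + w * ((-a) ^ n / fact n / (of_nat n + w)) = (of_nat n + w) * ((-a) ^ n / fact n / (of_nat n + w))"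
      by (simp only: distrib_right)
    thus "?g n + w * ((-a) ^ n / fact n / (of_nat n + w)) = (-a) ^ n / fact n" using nz[of n] by simp
  qed
  finally show ?thesis using exp_term_sums[of "-a"] sums_unique2 by (fastforce simp: algebra_simps)
qed

text \<open>Expand \<open>exp (- a * s)\<close>; as \<open>s <= 1\<close>, the powers
  \<open>s ^ n\<close> are at most 1 and the exponential series of \<open>norm a\<close>
  dominates.\<close>

lemma lower_gamma_conv_integral:
  assumes "Re w > 0" "w \<notin> \<int>"
  shows "(LBINT s:{0<..1}. gamma_kernel w a s) = lower_gamma w a"
proof -
  let ?g = "\<lambda>n s. (-a) ^ n / fact n * complex_of_real s powr (w + of_nat n - 1)"
  have g: "?g n s = of_real s powr (w - 1) * ((- a * of_real s) ^ n / fact n)" if "s > 0" for n s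
    using that powr_add[of "complex_of_real s" "w - 1" "of_nat n"]
    by (simp add: powr_nat' power_mult_distrib field_simps)
       (simp add: power_minus[of a] power_minus[of "a * of_real s"] power_mult_distrib field_simps)
  have int: "set_integrable lborel {0<..1} (\<lambda>s. norm (complex_of_real s powr (w - 1)))"
    by (intro set_integrable_norm powr_integral_0_1 assms)
  have gint: "set_integrable lborel {0<..1} (?g n)" for n
    using assms by (intro set_integrable_mult_right powr_integral_0_1) auto
  have "(\<lambda>n. LBINT s:{0<..1}. ?g n s) sums (LBINT s:{0<..1}. gamma_kernel w a s)"
  proof (rule set_integral_sums[OF gint])
    fix s :: real assume s: "s \<in> {0<..1}"
    have "summable (\<lambda>n. norm (complex_of_real s powr (w - 1)) * (norm (a * of_real s) ^ n / fact n))"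
      by (intro summable_mult sums_summable[OF exp_term_sums])
    also have "(\<lambda>n. norm (complex_of_real s powr (w - 1)) * (norm (a * of_real s) ^ n / fact n)) = (\<lambda>n. norm (?g n s))"
      using s by (intro ext) (simp only: g greaterThanAtMost_iff, simp add: norm_mult norm_divide norm_power)
    finally show "summable (\<lambda>n. norm (?g n s))" .
    have "(\<lambda>n. of_real s powr (w - 1) * ((- a * of_real s) ^ n / fact n)) sums gamma_kernel w a s"
      unfolding gamma_kernel_def by (intro sums_mult exp_term_sums)
    thus "(\<lambda>n. ?g n s) sums gamma_kernel w a s"
      using s by (simp only: g greaterThanAtMost_iff)
  next
    let ?C = "LBINT s:{0<..1}. norm (complex_of_real s powr (w - 1))"
    show "summable (\<lambda>n. LBINT s:{0<..1}. norm (?g n s))"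
    proof (rule summable_comparison_test')
      show "summable (\<lambda>n. norm a ^ n / fact n * ?C)"
        by (intro summable_mult2 sums_summable[OF exp_term_sums])
      fix n
      have "(LBINT s:{0<..1}. norm (?g n s)) \<le> (LBINT s:{0<..1}. norm a ^ n / fact n * norm (complex_of_real s powr (w - 1)))"
      proof (rule set_integral_mono)
        fix s :: real assume s: "s \<in> {0<..1}"
        have "s powr (Re w + real n - 1) \<le> s powr (Re w - 1)"
          using s by (intro powr_mono') auto
        thus "norm (?g n s) \<le> norm a ^ n / fact n * norm (complex_of_real s powr (w - 1))"
          using s by (auto simp: norm_mult norm_divide norm_power norm_powr_real_powr intro!: mult_left_mono divide_right_mono)
      qed (intro set_integrable_norm gint set_integrable_mult_right int)+
      also have "\<dots> = norm a ^ n / fact n * ?C" by (rule set_integral_mult_right)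
      finally show "norm (LBINT s:{0<..1}. norm (?g n s)) \<le> norm a ^ n / fact n * ?C"
        by (simp add: set_lebesgue_integral_def integral_nonneg_AE)
    qed
  qed
  also have "(\<lambda>n. LBINT s:{0<..1}. ?g n s) = (\<lambda>n. (-a) ^ n / fact n / (of_nat n + w))"
    using assms powr_integral_0_1(2)[of "w + of_nat n" for n] by (auto simp: add.commute)
  finally show ?thesis using lower_gamma_sums(2)[OF assms(2)] sums_unique2 by blast
qed

text \<open>For \<open>Re w > 0\<close> this is Euler's integral split at 1. The induction moves the
  half-plane of validity left by one: the terms \<open>exp (-a)\<close> of the two recurrences
  cancel, so the right-hand side obeys the functional equation of Gamma.\<close>

lemma Gamma_conv_lower_upper_gamma:
  assumes "Re a > 0" "w \<notin> \<int>"
  shows "Gamma w = a powr w * (lower_gamma w a + upper_gamma w a)"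
proof -
  have a: "a \<noteq> 0" using assms by auto
  have "Re w > - real N \<Longrightarrow> w \<notin> \<int> \<Longrightarrow> Gamma w = a powr w * (lower_gamma w a + upper_gamma w a)" for N
  proof (induction N arbitrary: w)
    case 0
    hence w: "Re w > 0" by simp
    have int: "set_integrable lborel {0<..} (gamma_kernel w a)"
      by (intro gamma_kernel_integrable w assms)
    have "(LBINT s:{0<..1} \<union> {1<..}. gamma_kernel w a s) =
        (LBINT s:{0<..1}. gamma_kernel w a s) + (LBINT s:{1<..}. gamma_kernel w a s)"
      by (intro set_integral_Un set_integrable_subset[OF int]) auto
    also have "{0<..1} \<union> {1<..} = {0::real<..}" by auto
    finally have "Gamma w * a powr (-w) = lower_gamma w a + upper_gamma w a"
      using gamma_kernel_integral[OF w assms(1)] lower_gamma_conv_integral[OF w 0(2)]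
      by (simp add: upper_gamma_def)
    thus ?case using a by (simp add: powr_minus field_simps)
  next
    case (Suc N)
    have w1: "w + 1 \<notin> \<int>" using Suc.prems Ints_diff[of "w + 1" 1] by auto
    have w0: "w \<noteq> 0" using Suc.prems by auto
    have "w * Gamma w = Gamma (w + 1)"
      using Suc.prems nonpos_Ints_Int by (subst Gamma_plus1) auto
    also have "\<dots> = a powr (w + 1) * (lower_gamma (w + 1) a + upper_gamma (w + 1) a)"
      using Suc.prems w1 by (intro Suc.IH) auto
    also have "\<dots> = a powr w * (a * lower_gamma (w + 1) a + a * upper_gamma (w + 1) a)"
      using a by (simp add: powr_add algebra_simps)
    also have "\<dots> = w * (a powr w * (lower_gamma w a + upper_gamma w a))"
      using lower_gamma_rec[OF Suc.prems(2), of a] upper_gamma_rec[OF assms(1), of w]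
      by (metis add.assoc add.commute distrib_left mult.left_commute)
    finally show ?case using w0 by simp
  qed
  moreover obtain N where "- Re w < real N" using reals_Archimedean2 by blast
  ultimately show ?thesis using assms(2) by (metis minus_less_iff)
qed

section \<open>The Macdonald function as an integral\<close>

lemma noninteger_diff_of_nat: "w \<notin> \<int> \<Longrightarrow> w - of_nat k \<notin> \<int>"
  for w :: complex
  using Ints_add[of "w - of_nat k" "of_nat k"] by auto

text \<open>Exchanging \<open>k\<close> and \<open>n\<close> and replacing \<open>w\<close> by
  \<open>-w\<close> reverses the sign of the denominator \<open>n - k + w\<close>. Absolute
  summability over all pairs makes the two iterated sums opposite; \<open>X\<close> stays abstract
  because it cancels later.\<close>

lemma lower_gamma_double_series_antisym:
  assumes "w \<notin> \<int>"
  obtains X where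
    "(\<lambda>k. (-a) ^ k / fact k * lower_gamma (w - of_nat k) a) sums X"
    "(\<lambda>k. (-a) ^ k / fact k * lower_gamma (- w - of_nat k) a) sums (- X)"
proof -
  define c where "c = (\<lambda>w (k, n). (-a) ^ k / fact k * ((-a) ^ n / fact n / (of_nat n + (w - of_nat k))))"
  have inner: "((\<lambda>n. c v (k, n)) has_sum (-a) ^ k / fact k * lower_gamma (v - of_nat k) a) UNIV"
    if "v \<notin> \<int>" for v k
    unfolding c_def prod.case
    by (intro has_sum_cmult_right norm_summable_imp_has_sum lower_gamma_sums noninteger_diff_of_nat that)
  obtain \<delta> where \<delta>: "\<delta> > 0" "\<And>m. m \<in> \<int> \<Longrightarrow> \<delta> \<le> norm (m + w)"
    using noninteger_separated[OF assms] by blast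
  have exps: "((\<lambda>n. norm a ^ n / fact n) has_sum exp (norm a)) UNIV"
    by (intro sums_nonneg_imp_has_sum exp_term_sums) auto
  \<comment> \<open>Since \<open>n - k\<close> is an integer, one gap bounds every denominator from
    below; what remains is a product of two exponential series.\<close>
  have "(\<lambda>(k, n). norm a ^ k / fact k * (norm a ^ n / fact n) / \<delta>) summable_on (UNIV \<times> UNIV)"
  proof (rule summable_on_SigmaI)
    show "((\<lambda>n. case (k, n) of (k, n) \<Rightarrow> norm a ^ k / fact k * (norm a ^ n / fact n) / \<delta>)
        has_sum norm a ^ k / fact k * exp (norm a) / \<delta>) UNIV" for k
      unfolding prod.case by (intro has_sum_divide_const has_sum_cmult_right exps)
    show "(\<lambda>k. norm a ^ k / fact k * exp (norm a) / \<delta>) summable_on UNIV"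
      using has_sum_divide_const[OF has_sum_cmult_left[OF exps]] by (rule has_sum_imp_summable)
  qed (use \<delta> in auto)
  hence "(\<lambda>p. norm (c w p)) summable_on (UNIV \<times> UNIV)"
  proof (rule Infinite_Sum.abs_summable_on_comparison_test')
    fix p :: "nat \<times> nat"
    obtain k n where p: "p = (k, n)" by (cases p)
    have "\<delta> \<le> norm (of_nat n + (w - of_nat k))"
      using \<delta>(2)[of "of_nat n - of_nat k"] by (simp add: algebra_simps)
    thus "norm (c w p) \<le> (case p of (k, n) \<Rightarrow> norm a ^ k / fact k * (norm a ^ n / fact n) / \<delta>)"
      using \<delta>(1) by (auto simp: p c_def norm_mult norm_divide norm_power intro!: frac_le mult_left_mono)
  qed
  hence "c w summable_on (UNIV \<times> UNIV)" by (rule abs_summable_summable)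
  then obtain X where X: "(c w has_sum X) (UNIV \<times> UNIV)" by (auto simp: summable_on_def)
  have "c (-w) p = - (case p of (k, n) \<Rightarrow> c w (n, k))" for p
  proof -
    obtain k n where p: "p = (k, n)" by (cases p)
    have "of_nat n + (- w - of_nat k) = - (of_nat k + (w - of_nat n))" by simp
    thus ?thesis unfolding p c_def prod.case by (simp only: divide_minus_right) (simp add: mult_ac)
  qed
  moreover have "((\<lambda>p. - (case p of (k, n) \<Rightarrow> c w (n, k))) has_sum (- X)) (UNIV \<times> UNIV)"
    using X by (subst (asm) has_sum_swap) (simp add: has_sum_uminus)
  ultimately have X': "(c (-w) has_sum (-X)) (UNIV \<times> UNIV)" by (simp cong: has_sum_cong)
  show ?thesis
  proof (rule that)
    show "(\<lambda>k. (-a) ^ k / fact k * lower_gamma (w - of_nat k) a) sums X"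
      by (rule has_sum_imp_sums, rule has_sum_SigmaD[OF X]) (use assms inner in auto)
    show "(\<lambda>k. (-a) ^ k / fact k * lower_gamma (- w - of_nat k) a) sums (- X)"
      by (rule has_sum_imp_sums, rule has_sum_SigmaD[OF X']) (use assms inner in auto)
  qed
qed

definition macdonald_kernel :: "complex \<Rightarrow> complex \<Rightarrow> real \<Rightarrow> complex" where
  "macdonald_kernel w a s = gamma_kernel w a s * exp (- a / of_real s)"

text \<open>The substitution of \<open>1 / s\<close> for \<open>s\<close> turns the integral of the
  kernel over \<open>0 < s < 1\<close> into \<open>half_macdonald (-w) a\<close>, so both together
  form the classical integral for twice the Macdonald function at \<open>2 * a\<close>.\<close>

definition half_macdonald :: "complex \<Rightarrow> complex \<Rightarrow> complex" where
  "half_macdonald w a = (LBINT s:{1<..}. macdonald_kernel w a s)"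

text \<open>Expand \<open>exp (- a / s)\<close>; for \<open>s > 1\<close> the powers
  \<open>1 / s ^ k\<close> are at most 1 and the exponential series of \<open>norm a\<close>
  dominates.\<close>

lemma upper_gamma_series:
  assumes "Re a > 0"
  shows "(\<lambda>k. (-a) ^ k / fact k * upper_gamma (w - of_nat k) a) sums half_macdonald w a"
proof -
  let ?g = "\<lambda>k s. (-a) ^ k / fact k * gamma_kernel (w - of_nat k) a s"
  have g: "?g k s = gamma_kernel w a s * ((- a / of_real s) ^ k / fact k)" if "s > 0" for k s
  proof -
    have "of_real s powr (w - of_nat k - 1) = of_real s powr (w - 1) / complex_of_real s ^ k"
      using that powr_diff[of "complex_of_real s" "w - 1" "of_nat k"]
      by (simp add: powr_nat' algebra_simps)
    moreover have "(- a / of_real s) ^ k = (-a) ^ k / of_real s ^ k"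
      by (simp only: power_divide)
    ultimately show ?thesis unfolding gamma_kernel_def by (simp only:) (simp add: mult_ac)
  qed
  have int: "set_integrable lborel {1<..} (\<lambda>s. norm (gamma_kernel w a s))"
    by (intro set_integrable_norm gamma_kernel_integrable_gt_1 assms)
  have gint: "set_integrable lborel {1<..} (?g k)" for k
    by (intro set_integrable_mult_right gamma_kernel_integrable_gt_1 assms)
  have "(\<lambda>k. LBINT s:{1<..}. ?g k s) sums (LBINT s:{1<..}. macdonald_kernel w a s)"
  proof (rule set_integral_sums[OF gint])
    fix s :: real assume "s \<in> {1<..}"
    hence s: "s > 0" by simp
    have "summable (\<lambda>k. norm (gamma_kernel w a s) * (norm (a / of_real s) ^ k / fact k))"
      by (intro summable_mult sums_summable[OF exp_term_sums])
    also have "(\<lambda>k. norm (gamma_kernel w a s) * (norm (a / of_real s) ^ k / fact k)) = (\<lambda>k. norm (?g k s))"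
      using s by (intro ext) (simp only: g, simp add: norm_mult norm_divide norm_power)
    finally show "summable (\<lambda>k. norm (?g k s))" .
    have "(\<lambda>k. gamma_kernel w a s * ((- a / of_real s) ^ k / fact k)) sums macdonald_kernel w a s"
      unfolding macdonald_kernel_def by (intro sums_mult exp_term_sums)
    thus "(\<lambda>k. ?g k s) sums macdonald_kernel w a s"
      using s by (simp only: g)
  next
    let ?C = "LBINT s:{1<..}. norm (gamma_kernel w a s)"
    show "summable (\<lambda>k. LBINT s:{1<..}. norm (?g k s))"
    proof (rule summable_comparison_test')
      show "summable (\<lambda>k. norm a ^ k / fact k * ?C)"
        by (intro summable_mult2 sums_summable[OF exp_term_sums])
      fix k
      have "(LBINT s:{1<..}. norm (?g k s)) \<le> (LBINT s:{1<..}. norm a ^ k / fact k * norm (gamma_kernel w a s))"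
      proof (rule set_integral_mono)
        fix s :: real assume s: "s \<in> {1<..}"
        have "s powr (Re w - real k - 1) \<le> s powr (Re w - 1)"
          using s by (intro powr_mono) auto
        thus "norm (?g k s) \<le> norm a ^ k / fact k * norm (gamma_kernel w a s)"
          using s by (auto simp: norm_mult norm_divide norm_power norm_gamma_kernel intro!: mult_left_mono mult_right_mono divide_right_mono)
      qed (intro set_integrable_norm gint set_integrable_mult_right int)+
      also have "\<dots> = norm a ^ k / fact k * ?C" by (rule set_integral_mult_right)
      finally show "norm (LBINT s:{1<..}. norm (?g k s)) \<le> norm a ^ k / fact k * ?C"
        by (simp add: set_lebesgue_integral_def integral_nonneg_AE)
    qed
  qed
  thus ?thesis by (simp add: upper_gamma_def half_macdonald_def)
qed

lemma sin_add_of_nat_pi: "sin (x + of_nat k * of_real pi) = (-1) ^ k * sin x" for x :: complex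
proof (induction k)
  case (Suc k)
  have "x + of_nat (Suc k) * of_real pi = (x + of_nat k * of_real pi) + of_real pi"
    by (simp add: algebra_simps)
  hence "sin (x + of_nat (Suc k) * of_real pi) = - sin (x + of_nat k * of_real pi)"
    by (simp only: sin_add) (simp flip: sin_of_real cos_of_real add: sin_of_real[symmetric])
  thus ?case using Suc.IH by simp
qed auto

text \<open>Reflection replaces \<open>rGamma (w + k + 1)\<close> by \<open>Gamma (- w - k)\<close>,
  to which Prym's decomposition applies. The sum \<open>X\<close> of the lower parts is a hypothesis
  so that \<open>w\<close> and \<open>-w\<close> can share one value up to sign.\<close>

lemma bessel_I_conv_gamma:
  assumes z: "Re z > 0" and w: "w \<notin> \<int>"
    and X: "(\<lambda>k. (-(z/2)) ^ k / fact k * lower_gamma (- w - of_nat k) (z/2)) sums X"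
  shows "bessel_I w z = - sin (w * of_real pi) / of_real pi * (X + half_macdonald (-w) (z/2))"
proof -
  define a where "a = z / 2"
  have a: "Re a > 0" "a \<noteq> 0" using z by (auto simp: a_def)
  \<comment> \<open>The powers of \<open>a\<close> combine to \<open>a ^ k\<close>: exponent
    \<open>2 * k\<close> from the series, \<open>w\<close> from the prefactor,
    \<open>- w - k\<close> from the decomposition.\<close>
  have coeff: "(z\<^sup>2 / 4) ^ k * rGamma (w + of_nat k + 1) / fact k * a powr w =
    - sin (w * of_real pi) / of_real pi *
      ((-a) ^ k / fact k * lower_gamma (- w - of_nat k) a + (-a) ^ k / fact k * upper_gamma (- w - of_nat k) a)" for k
  proof -
    have nonint: "- w - of_nat k \<notin> \<int>" using w by (intro noninteger_diff_of_nat) auto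
    hence nz: "- w - of_nat k \<notin> \<int>\<^sub>\<le>\<^sub>0" using nonpos_Ints_Int by blast
    let ?S = "lower_gamma (- w - of_nat k) a + upper_gamma (- w - of_nat k) a"
    have G: "Gamma (- w - of_nat k) = a powr (- w - of_nat k) * ?S"
      by (rule Gamma_conv_lower_upper_gamma) (use a nonint in auto)
    have "rGamma (w + of_nat k + 1) * rGamma (1 - (w + of_nat k + 1)) =
      sin (of_real pi * (w + of_nat k + 1)) / of_real pi"
      by (rule rGamma_reflection_complex)
    also have "1 - (w + of_nat k + 1) = - w - of_nat k" by simp
    \<comment> \<open>The shift is by \<open>k + 1\<close> multiples of pi, not \<open>k\<close>;
      the extra sign is the minus in the conclusion.\<close>
    also have "of_real pi * (w + of_nat k + 1) = w * of_real pi + of_nat (Suc k) * of_real pi"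
      by (simp add: algebra_simps)
    also have "sin \<dots> = (-1) ^ Suc k * sin (w * of_real pi)" by (rule sin_add_of_nat_pi)
    finally have refl: "rGamma (w + of_nat k + 1) * rGamma (- w - of_nat k) =
      (-1) ^ Suc k * sin (w * of_real pi) / of_real pi" .
    have "rGamma (- w - of_nat k) * Gamma (- w - of_nat k) = 1"
      using nz by (simp add: rGamma_inverse_Gamma Gamma_eq_zero_iff)
    hence "rGamma (w + of_nat k + 1) = rGamma (w + of_nat k + 1) * rGamma (- w - of_nat k) * Gamma (- w - of_nat k)"
      by simp
    also have "\<dots> = (-1) ^ Suc k * sin (w * of_real pi) / of_real pi * (a powr (- w - of_nat k) * ?S)"
      by (simp only: refl G)
    finally have r: "rGamma (w + of_nat k + 1) = (-1) ^ Suc k * sin (w * of_real pi) / of_real pi * (a powr (- w - of_nat k) * ?S)" .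
    have p: "a powr (- w - of_nat k) = 1 / (a powr w * a ^ k)"
      using a by (simp add: powr_diff powr_nat' powr_minus field_simps)
    have q: "(z\<^sup>2 / 4) ^ k = a ^ k * a ^ k"
      by (simp add: a_def power2_eq_square flip: power_mult_distrib)
    have pow: "(-a) ^ k = (-1) ^ k * a ^ k" by (rule power_minus)
    show ?thesis unfolding r p q pow using a by (simp add: field_simps)
  qed
  have "(\<lambda>k. (z\<^sup>2 / 4) ^ k * rGamma (w + of_nat k + 1) / fact k * a powr w) sums
     (- sin (w * of_real pi) / of_real pi * (X + half_macdonald (-w) a))"
    unfolding coeff using X upper_gamma_series[OF a(1)] by (intro sums_mult sums_add) (simp_all add: a_def)
  hence "(\<lambda>k. (z\<^sup>2 / 4) ^ k * rGamma (w + of_nat k + 1) / fact k) sums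
     (- sin (w * of_real pi) / of_real pi * (X + half_macdonald (-w) a) / a powr w)"
    using a by (auto dest: sums_divide[where c = "a powr w"])
  thus ?thesis using a by (simp add: bessel_I_def sums_iff a_def)
qed

lemma sin_pi_eq_0_iff_Ints: "sin (w * of_real pi) = 0 \<longleftrightarrow> w \<in> \<int>" for w :: complex
  by (auto simp: sin_eq_0 elim!: Ints_cases)

text \<open>Both Bessel functions contain the same term \<open>sin (w * pi) / pi * X\<close>, which
  drops out of the difference; the sine then cancels.\<close>

lemma bessel_I_quotient:
  assumes z: "Re z > 0" and w: "w \<notin> \<int>"
  shows "of_real (pi / 2) * (bessel_I (- w) z - bessel_I w z) / sin (w * of_real pi) =
    (half_macdonald w (z/2) + half_macdonald (-w) (z/2)) / 2"
proof -
  obtain X where X: "(\<lambda>k. (-(z/2)) ^ k / fact k * lower_gamma (w - of_nat k) (z/2)) sums X"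
    "(\<lambda>k. (-(z/2)) ^ k / fact k * lower_gamma (- w - of_nat k) (z/2)) sums (- X)"
    using lower_gamma_double_series_antisym[OF w] by blast
  have "bessel_I w z = - sin (w * of_real pi) / of_real pi * (- X + half_macdonald (-w) (z/2))"
    by (rule bessel_I_conv_gamma[OF z w X(2)])
  moreover have "bessel_I (-w) z = - sin (- w * of_real pi) / of_real pi * (X + half_macdonald (-(-w)) (z/2))"
    by (rule bessel_I_conv_gamma[OF z]) (use w X(1) in auto)
  moreover have "sin (w * of_real pi) \<noteq> 0" using w by (simp add: sin_pi_eq_0_iff_Ints)
  ultimately show ?thesis by (simp only:) (simp add: field_simps)
qed

section \<open>Integrability, continuity and decay of the Macdonald function\<close>

lemma norm_macdonald_kernel_le:
  assumes "Re a \<ge> 0" "s > 0"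
  shows "norm (macdonald_kernel w a s) \<le> norm (gamma_kernel w a s)"
proof -
  have "Re (- a / of_real s) \<le> 0" using assms by (simp add: Re_divide_of_real)
  hence "norm (exp (- a / of_real s)) \<le> 1" by (simp add: norm_exp_eq_Re)
  thus ?thesis
    using mult_left_mono[of "norm (exp (- a / of_real s))" 1 "norm (gamma_kernel w a s)"]
    by (simp add: macdonald_kernel_def norm_mult)
qed

lemma continuous_on_macdonald_kernel: "A \<subseteq> {0<..} \<Longrightarrow> continuous_on A (macdonald_kernel w a)"
  unfolding macdonald_kernel_def by (intro continuous_intros) auto

lemma macdonald_kernel_integrable:
  assumes "Re a > 0"
  shows "set_integrable lborel {1<..} (macdonald_kernel w a)"
proof (rule set_integrable_continuous_bound)
  show "set_integrable lborel {1<..} (\<lambda>s. norm (gamma_kernel w a s))"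
    by (intro set_integrable_norm gamma_kernel_integrable_gt_1 assms)
qed (use assms in \<open>auto intro!: continuous_on_macdonald_kernel norm_macdonald_kernel_le\<close>)

text \<open>Dominated convergence with majorant \<open>gamma_kernel (w + 1) (a / 2)\<close> on
  \<open>s > 1\<close>. Varying the order serves integer orders, varying the argument serves
  continuity of \<open>bessel_K\<close>.\<close>

lemma tendsto_half_macdonald:
  fixes W Z :: "nat \<Rightarrow> complex"
  assumes W: "W \<longlonglongrightarrow> w" and Z: "Z \<longlonglongrightarrow> a" and a: "Re a > 0"
  shows "(\<lambda>n. half_macdonald (W n) (Z n)) \<longlonglongrightarrow> half_macdonald w a"
proof -
  have "\<forall>\<^sub>F n in sequentially. Re (Z n) > Re a / 2"
    using tendsto_Re[OF Z] a by (intro order_tendstoD) auto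
  moreover have "\<forall>\<^sub>F n in sequentially. Re (W n) < Re w + 1"
    using tendsto_Re[OF W] by (intro order_tendstoD) auto
  ultimately have "\<forall>\<^sub>F n in sequentially. Re (Z n) > Re a / 2 \<and> Re (W n) < Re w + 1"
    by eventually_elim auto
  then obtain N where N: "\<And>n. n \<ge> N \<Longrightarrow> Re (Z n) > Re a / 2" "\<And>n. n \<ge> N \<Longrightarrow> Re (W n) < Re w + 1"
    by (auto simp: eventually_sequentially)
  show ?thesis
    unfolding half_macdonald_def set_lebesgue_integral_def
  \<comment> \<open>Dropping the first \<open>N\<close> terms makes the bounds on \<open>W\<close>
    and \<open>Z\<close> hold at every index.\<close>
  proof (rule LIMSEQ_offset[of _ N], rule integral_dominated_convergence)
    show "integrable lborel (\<lambda>s. indicator {1<..} s *\<^sub>R norm (gamma_kernel (w + 1) (a / 2) s))"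
      using a gamma_kernel_integrable_gt_1[of "a / 2" "w + 1", THEN set_integrable_norm]
      by (simp add: set_integrable_def)
    show "(\<lambda>s. indicator {1<..} s *\<^sub>R macdonald_kernel w a s) \<in> borel_measurable lborel"
      using macdonald_kernel_integrable[OF a] by (auto simp: set_integrable_def)
    have "Re (Z (n + N)) > 0" for n using N(1)[of "n + N"] a by simp
    thus "(\<lambda>s. indicator {1<..} s *\<^sub>R macdonald_kernel (W (n + N)) (Z (n + N)) s) \<in> borel_measurable lborel" for n
      using macdonald_kernel_integrable by (auto simp: set_integrable_def)
    show "AE s in lborel. (\<lambda>n. indicator {1<..} s *\<^sub>R macdonald_kernel (W (n + N)) (Z (n + N)) s)
       \<longlonglongrightarrow> indicator {1<..} s *\<^sub>R macdonald_kernel w a s"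
    proof (rule AE_I2)
      fix s :: real
      show "(\<lambda>n. indicator {1<..} s *\<^sub>R macdonald_kernel (W (n + N)) (Z (n + N)) s)
         \<longlonglongrightarrow> indicator {1<..} s *\<^sub>R macdonald_kernel w a s"
      proof (cases "s > 1")
        case True
        have "(\<lambda>n. macdonald_kernel (W (n + N)) (Z (n + N)) s) \<longlonglongrightarrow> macdonald_kernel w a s"
          unfolding macdonald_kernel_def gamma_kernel_def
          using True LIMSEQ_ignore_initial_segment[OF W] LIMSEQ_ignore_initial_segment[OF Z]
          by (intro tendsto_intros) (auto simp: complex_nonpos_Reals_iff)
        thus ?thesis using True by simp
      qed auto
    qed
    show "AE s in lborel. norm (indicator {1<..} s *\<^sub>R macdonald_kernel (W (n + N)) (Z (n + N)) s)
       \<le> indicator {1<..} s *\<^sub>R norm (gamma_kernel (w + 1) (a / 2) s)" for n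
    proof (rule AE_I2)
      fix s :: real
      let ?w = "W (n + N)" and ?a = "Z (n + N)"
      have n: "Re ?a > Re a / 2" "Re ?w < Re w + 1" using N[of "n + N"] by auto
      show "norm (indicator {1<..} s *\<^sub>R macdonald_kernel ?w ?a s)
       \<le> indicator {1<..} s *\<^sub>R norm (gamma_kernel (w + 1) (a / 2) s)"
      proof (cases "s > 1")
        case True
        have "norm (macdonald_kernel ?w ?a s) \<le> norm (gamma_kernel ?w ?a s)"
          using True n a by (intro norm_macdonald_kernel_le) auto
        also have "\<dots> \<le> norm (gamma_kernel (w + 1) (a / 2) s)"
          using True n a by (auto simp: norm_gamma_kernel intro!: mult_mono powr_mono)
        finally show ?thesis using True by simp
      qed auto
    qed
  qed
qed

text \<open>At an integer order \<open>bessel_K\<close> is a limit over the order; the non-integer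
  formula holds on a punctured neighbourhood, and its right-hand side is continuous in the
  order.\<close>

lemma bessel_K_integral_representation:
  assumes z: "Re z > 0"
  shows "bessel_K w z = (half_macdonald w (z/2) + half_macdonald (-w) (z/2)) / 2"
proof (cases "w \<in> \<int>")
  case False
  thus ?thesis using bessel_I_quotient[OF z False] by (simp add: bessel_K_def Let_def)
next
  case True
  let ?Q = "\<lambda>\<kappa>. of_real (pi / 2) * (bessel_I (- \<kappa>) z - bessel_I \<kappa> z) / sin (\<kappa> * of_real pi)"
  let ?H = "\<lambda>w. (half_macdonald w (z/2) + half_macdonald (-w) (z/2)) / 2"
  have "(?H \<longlongrightarrow> ?H w) (at w)"
    unfolding tendsto_at_iff_sequentially o_def
    using z by (intro allI impI tendsto_intros tendsto_half_macdonald) auto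
  moreover have "\<forall>\<^sub>F \<kappa> in at w. ?H \<kappa> = ?Q \<kappa>"
  proof -
    \<comment> \<open>The integers other than \<open>w\<close> form a closed set, so orders close to
      but different from \<open>w\<close> are not integers.\<close>
    have "open (- (\<int> - {w}))" by (intro open_Compl closed_subset_Ints) auto
    hence "\<forall>\<^sub>F \<kappa> in at w. \<kappa> \<in> - (\<int> - {w})" by (intro eventually_at_in_open') auto
    moreover have "\<forall>\<^sub>F \<kappa> in at w. \<kappa> \<noteq> w" by (simp add: eventually_at_filter)
    ultimately show ?thesis
      by eventually_elim (use bessel_I_quotient[OF z] in auto)
  qed
  ultimately have "(?Q \<longlongrightarrow> ?H w) (at w)" by (rule Lim_transform_eventually)
  hence "Lim (at w) ?Q = ?H w" by (intro tendsto_Lim) auto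
  thus ?thesis using True by (simp add: bessel_K_def Let_def)
qed

lemma continuous_on_bessel_K: "continuous_on {z. Re z > 0} (bessel_K w)"
  unfolding continuous_on_sequentially o_def
proof (intro allI ballI impI)
  fix Z z assume z: "z \<in> {z. Re z > 0}" and Z: "(\<forall>n. Z n \<in> {z. Re z > 0}) \<and> Z \<longlonglongrightarrow> z"
  have "(\<lambda>n. (half_macdonald w (Z n/2) + half_macdonald (-w) (Z n/2)) / 2) \<longlonglongrightarrow>
      (half_macdonald w (z/2) + half_macdonald (-w) (z/2)) / 2"
    using z Z by (intro tendsto_intros tendsto_half_macdonald) auto
  thus "(\<lambda>n. bessel_K w (Z n)) \<longlonglongrightarrow> bessel_K w z"
    using z Z by (simp add: bessel_K_integral_representation)
qed

text \<open>Halve the exponent \<open>Re a * s\<close>: one half, with \<open>Re a\<close> lowered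
  to \<open>e\<close>, keeps the integral finite and yields \<open>C\<close>; the other is at least
  \<open>Re a / 2\<close> because \<open>s > 1\<close>.\<close>

lemma half_macdonald_exp_decay:
  assumes "e > 0"
  obtains C where "\<And>a. Re a \<ge> e \<Longrightarrow> norm (half_macdonald w a) \<le> C * exp (- Re a / 2)"
proof
  fix a assume a: "Re a \<ge> e"
  let ?g = "\<lambda>s. norm (gamma_kernel w (of_real (e/2)) s)"
  have "norm (half_macdonald w a) \<le> (LBINT s:{1<..}. norm (macdonald_kernel w a s))"
    unfolding half_macdonald_def using a assms
    by (intro set_integral_norm_bound macdonald_kernel_integrable) auto
  also have "\<dots> \<le> (LBINT s:{1<..}. ?g s * exp (- Re a / 2))"
  proof (rule set_integral_mono)
    show "set_integrable lborel {1<..} (\<lambda>s. norm (macdonald_kernel w a s))"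
      using a assms by (intro set_integrable_norm macdonald_kernel_integrable) auto
    show "set_integrable lborel {1<..} (\<lambda>s. ?g s * exp (- Re a / 2))"
      using assms by (intro set_integrable_mult_left set_integrable_norm gamma_kernel_integrable_gt_1) auto
    fix s :: real assume s: "s \<in> {1<..}"
    have "e / 2 * s + Re a / 2 * 1 \<le> Re a / 2 * s + Re a / 2 * s"
      using s a assms by (intro add_mono mult_mono) auto
    hence "exp (- Re a * s) \<le> exp (- (e / 2) * s) * exp (- Re a / 2)"
      by (simp add: mult.commute flip: exp_add)
    hence "norm (gamma_kernel w a s) \<le> ?g s * exp (- Re a / 2)"
      using s by (auto simp: norm_gamma_kernel mult.assoc intro!: mult_left_mono)
    thus "norm (macdonald_kernel w a s) \<le> ?g s * exp (- Re a / 2)"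
      using norm_macdonald_kernel_le[of a s w] a s assms by auto
  qed
  also have "\<dots> = (LBINT s:{1<..}. ?g s) * exp (- Re a / 2)" by (rule set_integral_mult_left)
  finally show "norm (half_macdonald w a) \<le> (LBINT s:{1<..}. ?g s) * exp (- Re a / 2)" .
qed

text \<open>The rate 1/4 is the rate 1/2 of the two halves at the argument \<open>z / 2\<close>; any
  positive rate would serve below.\<close>

lemma bessel_K_exp_decay:
  assumes "e > 0"
  obtains C where "\<And>z. Re z \<ge> e \<Longrightarrow> norm (bessel_K w z) \<le> C * exp (- Re z / 4)"
proof -
  obtain C1 where C1: "\<And>a. Re a \<ge> e/2 \<Longrightarrow> norm (half_macdonald w a) \<le> C1 * exp (- Re a / 2)"
    using half_macdonald_exp_decay[of "e/2"] assms by auto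
  obtain C2 where C2: "\<And>a. Re a \<ge> e/2 \<Longrightarrow> norm (half_macdonald (-w) a) \<le> C2 * exp (- Re a / 2)"
    using half_macdonald_exp_decay[of "e/2"] assms by auto
  show ?thesis
  proof
    fix z assume z: "Re z \<ge> e"
    have "norm (bessel_K w z) \<le> (norm (half_macdonald w (z/2)) + norm (half_macdonald (-w) (z/2))) / 2"
      using z assms norm_triangle_ineq by (simp add: bessel_K_integral_representation norm_divide)
    also have "\<dots> \<le> (C1 * exp (- Re (z/2) / 2) + C2 * exp (- Re (z/2) / 2)) / 2"
      using z by (intro divide_right_mono add_mono C1 C2) auto
    also have "\<dots> = (C1 + C2) / 2 * exp (- Re z / 4)" by (simp add: algebra_simps)
    finally show "norm (bessel_K w z) \<le> (C1 + C2) / 2 * exp (- Re z / 4)" .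
  qed
qed

section \<open>The extended Beta integral\<close>

text \<open>To be used with \<open>u = 1 / t\<close> and \<open>u = 1 / (1 - t)\<close> at the two
  ends of the unit interval.\<close>

lemma powr_exp_bounded:
  fixes \<alpha> c :: real
  assumes "c > 0"
  obtains B where "B \<ge> 0" "\<And>u. u \<ge> 1 \<Longrightarrow> u powr \<alpha> * exp (- c * u) \<le> B"
proof -
  have "((\<lambda>u. u powr \<alpha> * exp (- c * u)) \<longlongrightarrow> 0) at_top"
    using assms by real_asymp
  hence "\<forall>\<^sub>F u in at_top. u powr \<alpha> * exp (- c * u) < 1" by (rule order_tendstoD) simp
  then obtain U where U: "\<And>u. u \<ge> U \<Longrightarrow> u powr \<alpha> * exp (- c * u) < 1"
    by (auto simp: eventually_at_top_linorder)
  show ?thesis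
  proof
    fix u :: real assume u: "u \<ge> 1"
    \<comment> \<open>The bound 1 covers \<open>u >= U\<close>; below \<open>U\<close> the
      exponential is at most 1, and the absolute value in the exponent makes the power
      increasing.\<close>
    show "u powr \<alpha> * exp (- c * u) \<le> max 1 (U powr \<bar>\<alpha>\<bar>)"
    proof (cases "u \<ge> U")
      case True
      thus ?thesis using U[of u] by simp
    next
      case False
      have "u powr \<alpha> * exp (- c * u) \<le> u powr \<bar>\<alpha>\<bar> * 1"
        using u assms by (intro mult_mono powr_mono) auto
      also have "\<dots> \<le> U powr \<bar>\<alpha>\<bar>" using u False by (simp add: powr_mono2)
      finally show ?thesis by simp
    qed
  qed auto
qed

text \<open>Integrability is transferred from \<open>h\<close> to \<open>f\<close>, so \<open>g\<close> maps the interval of the known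
  integral to that of the new one; below it is the inverse of the usual substitution.\<close>

lemma interval_integral_substitution_complex:
  fixes f :: "real \<Rightarrow> complex" and a b A B :: ereal
  assumes "a < b" "A \<le> B"
    and deriv_g: "\<And>x. a < ereal x \<Longrightarrow> ereal x < b \<Longrightarrow> DERIV g x :> g' x"
    and range_g: "\<And>x. a < ereal x \<Longrightarrow> ereal x < b \<Longrightarrow> g x \<in> einterval A B"
    and contf: "continuous_on (einterval A B) f"
    and contg': "\<And>x. a < ereal x \<Longrightarrow> ereal x < b \<Longrightarrow> isCont g' x"
    and g'_nonneg: "\<And>x. a \<le> ereal x \<Longrightarrow> ereal x \<le> b \<Longrightarrow> 0 \<le> g' x"
    and A: "((ereal \<circ> g \<circ> real_of_ereal) \<longlongrightarrow> A) (at_right a)"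
    and B: "((ereal \<circ> g \<circ> real_of_ereal) \<longlongrightarrow> B) (at_left b)"
    and eq: "\<And>x. a < ereal x \<Longrightarrow> ereal x < b \<Longrightarrow> g' x *\<^sub>R f (g x) = h x"
    and int: "set_integrable lborel (einterval a b) h"
  shows "interval_lebesgue_integrable lborel A B f"
    and "(LBINT x=A..B. f x) = (LBINT x=a..b. h x)"
proof -
  have isCont: "isCont f (g x)" if "a < ereal x" "ereal x < b" for x
    using contf range_g[OF that] by (simp add: continuous_on_eq_continuous_at)
  have eq': "x \<in> einterval a b \<Longrightarrow> g' x *\<^sub>R f (g x) = h x" for x
    using eq by (auto simp: einterval_def)
  have int1: "set_integrable lborel (einterval a b) (\<lambda>x. g' x *\<^sub>R f (g x))"
    using int by (subst set_integrable_cong[OF refl refl]) (auto simp: eq')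
  \<comment> \<open>The nonnegative substitution rule, applied to norms, yields the integrability of
    \<open>f\<close> that the complex rule presupposes.\<close>
  have "set_integrable lborel (einterval a b) (\<lambda>x. norm (f (g x)) * g' x)"
  proof (subst set_integrable_cong[OF refl refl])
    fix x assume "x \<in> einterval a b"
    hence "g' x \<ge> 0" using g'_nonneg[of x] by (auto simp: einterval_def)
    thus "norm (f (g x)) * g' x = norm (g' x *\<^sub>R f (g x))" by simp
  qed (rule set_integrable_norm[OF int1])
  hence "set_integrable lborel (einterval A B) (\<lambda>x. norm (f x))"
    using isCont by (intro interval_integral_substitution_nonneg(1)[OF \<open>a < b\<close> deriv_g _ contg' _ g'_nonneg A B])
      (auto intro!: continuous_intros)
  hence int2: "set_integrable lborel (einterval A B) f"
    by (intro set_integrable_continuous_bound[OF _ contf]) auto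
  thus "interval_lebesgue_integrable lborel A B f"
    using \<open>A \<le> B\<close> by (simp add: interval_lebesgue_integrable_def)
  have "(LBINT x=A..B. f x) = (LBINT x=a..b. g' x *\<^sub>R f (g x))"
    by (rule interval_integral_substitution_integrable[OF \<open>a < b\<close> deriv_g isCont contg' g'_nonneg A B int1 int2])
  also have "\<dots> = (LBINT x=a..b. h x)"
    using \<open>a < b\<close> by (intro interval_integral_cong) (auto simp: eq' min_absorb1 max_absorb2 less_imp_le)
  finally show "(LBINT x=A..B. f x) = (LBINT x=a..b. h x)" .
qed

section \<open>Convergence and symmetry of the Beta integral\<close>

definition ext_Beta_integrand :: "complex \<Rightarrow> complex \<Rightarrow> complex \<Rightarrow> complex \<Rightarrow> real \<Rightarrow> complex" where
  "ext_Beta_integrand \<nu> x y p t = of_real t powr (x - 3/2) * of_real (1 - t) powr (y - 3/2) *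
     bessel_K (\<nu> + 1/2) (p / of_real (t * (1 - t)))"

lemma einterval_0_1: "einterval 0 1 = {0<..<1}"
  by (auto simp: einterval_def zero_ereal_def one_ereal_def)

lemma continuous_on_of_real_powr:
  assumes "continuous_on S r" "\<And>x. x \<in> S \<Longrightarrow> r x > (0::real)"
  shows "continuous_on S (\<lambda>x. complex_of_real (r x) powr w)"
  using assms by (intro continuous_intros) (force simp: complex_nonpos_Reals_iff)+

text \<open>Positive multiples of \<open>p\<close> stay in the right half-plane; all arguments of
  \<open>bessel_K\<close> below have this form.\<close>

lemma continuous_on_bessel_K_ray:
  assumes "Re p > 0" "continuous_on S r" "\<And>x. x \<in> S \<Longrightarrow> r x > 0"
  shows "continuous_on S (\<lambda>x. bessel_K w (p * of_real (r x)))"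
  by (rule continuous_on_compose2[OF continuous_on_bessel_K])
     (use assms in \<open>auto intro!: continuous_intros\<close>)

text \<open>As \<open>1 / (t * (1 - t)) = 1 / t + 1 / (1 - t)\<close>, the decay of the Macdonald
  function splits into one exponential per endpoint, each beating the power there. Hence the
  integrand is bounded for all \<open>x\<close> and \<open>y\<close>.\<close>

lemma ext_Beta_integrand_integrable:
  assumes p: "Re p > 0"
  shows "set_integrable lborel (einterval 0 1) (ext_Beta_integrand \<nu> x y p)"
proof -
  obtain C where C: "\<And>z. Re z \<ge> Re p \<Longrightarrow> norm (bessel_K (\<nu> + 1/2) z) \<le> C * exp (- Re z / 4)"
    using bessel_K_exp_decay[OF p] by blast
  \<comment> \<open>The decay bound at \<open>z = p\<close> forces \<open>C\<close> to be
    nonnegative.\<close>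
  have "0 \<le> norm (bessel_K (\<nu> + 1/2) p)" by simp
  also have "\<dots> \<le> C * exp (- Re p / 4)" by (rule C) simp
  finally have C0: "C \<ge> 0" by (simp add: zero_le_mult_iff)
  define c where "c = Re p / 4"
  have c: "c > 0" using p by (simp add: c_def)
  obtain B1 where B1: "B1 \<ge> 0" "\<And>u. u \<ge> 1 \<Longrightarrow> u powr (- (Re x - 3/2)) * exp (- c * u) \<le> B1"
    using powr_exp_bounded[OF c] by blast
  obtain B2 where B2: "B2 \<ge> 0" "\<And>u. u \<ge> 1 \<Longrightarrow> u powr (- (Re y - 3/2)) * exp (- c * u) \<le> B2"
    using powr_exp_bounded[OF c] by blast
  show ?thesis unfolding einterval_0_1
  proof (rule set_integrable_continuous_bound)
    show "set_integrable lborel {0<..<1} (\<lambda>t::real. C * B1 * B2)"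
      by (simp add: set_integrable_def)
    have "continuous_on {0<..<1} (\<lambda>t. bessel_K (\<nu> + 1/2) (p * of_real (1 / (t * (1 - t)))))"
      using p by (intro continuous_on_bessel_K_ray continuous_intros) auto
    thus "continuous_on {0<..<1} (ext_Beta_integrand \<nu> x y p)"
      unfolding ext_Beta_integrand_def
      by (intro continuous_on_mult continuous_on_of_real_powr continuous_intros) auto
  next
    fix t :: real assume "t \<in> {0<..<1}"
    hence t: "t > 0" "1 - t > 0" by auto
    have q: "r powr \<alpha> * exp (- c / r) \<le> B"
      if "\<And>u. u \<ge> 1 \<Longrightarrow> u powr (- \<alpha>) * exp (- c * u) \<le> B" "r > 0" "r < 1" for r \<alpha> B
      using that(1)[of "1 / r"] that(2,3) by (simp add: powr_divide powr_minus field_simps)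
    have split: "1 / (t * (1 - t)) = 1 / t + 1 / (1 - t)" using t by (simp add: field_simps)
    have Re: "Re (p / of_real (t * (1 - t))) = 4 * c * (1 / t + 1 / (1 - t))"
      unfolding split[symmetric] Re_divide_of_real by (simp add: c_def)
    \<comment> \<open>This keeps the real part of the argument above \<open>Re p\<close>, the
      threshold for which \<open>C\<close> was obtained.\<close>
    have "t * (1 - t) \<le> 1" using t by (intro mult_le_one) auto
    hence "Re p \<le> Re (p / of_real (t * (1 - t)))"
      using t p by (simp add: Re_divide_of_real le_divide_eq mult_left_le del: of_real_mult of_real_diff)
    have "- (4 * c * (1 / t + 1 / (1 - t))) / 4 = - c / t + - c / (1 - t)"
      by (simp add: ring_distribs mult.commute)
    with C[OF \<open>Re p \<le> _\<close>] have "norm (bessel_K (\<nu> + 1/2) (p / of_real (t * (1 - t)))) \<le> C * (exp (- c / t) * exp (- c / (1 - t)))"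
      unfolding Re by (simp only: exp_add)
    hence "norm (ext_Beta_integrand \<nu> x y p t) \<le>
      t powr (Re x - 3/2) * (1 - t) powr (Re y - 3/2) * (C * (exp (- c / t) * exp (- c / (1 - t))))"
      unfolding ext_Beta_integrand_def norm_mult using t
      by (intro mult_mono) (auto simp: norm_powr_real_powr simp del: of_real_diff)
    also have "\<dots> = C * ((t powr (Re x - 3/2) * exp (- c / t)) * ((1 - t) powr (Re y - 3/2) * exp (- c / (1 - t))))"
      by (simp add: mult_ac)
    also have "\<dots> \<le> C * (B1 * B2)"
      using t by (intro mult_left_mono mult_mono q C0 B1 B2) auto
    finally show "norm (ext_Beta_integrand \<nu> x y p t) \<le> C * B1 * B2" by (simp add: mult_ac)
  qed auto
qed

text \<open>Reflection of \<open>t\<close> to \<open>1 - t\<close>; the trigonometric substitution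
  needs it.\<close>

lemma ext_Beta_integrand_integral_commute:
  "(LBINT t=0..1. ext_Beta_integrand \<nu> x y p t) = (LBINT t=0..1. ext_Beta_integrand \<nu> y x p t)"
proof -
  have "(LBINT t=0..1. ext_Beta_integrand \<nu> x y p t) =
      (\<integral>t. indicator {0<..<1} t *\<^sub>R ext_Beta_integrand \<nu> x y p t \<partial>lborel)"
    by (simp add: interval_lebesgue_integral_def einterval_0_1 set_lebesgue_integral_def)
  also have "\<dots> = (\<integral>t. indicator {0<..<1} (1 + -1 * t) *\<^sub>R ext_Beta_integrand \<nu> x y p (1 + -1 * t) \<partial>lborel)"
    by (subst lborel_integral_real_affine[of "-1" _ 1]) auto
  also have "(\<lambda>t. indicator {0<..<1} (1 + -1 * t) *\<^sub>R ext_Beta_integrand \<nu> x y p (1 + -1 * t)) =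
      (\<lambda>t. indicator {0<..<1} t *\<^sub>R ext_Beta_integrand \<nu> y x p t)"
    by (auto simp: fun_eq_iff indicator_def ext_Beta_integrand_def mult_ac)
  also have "(\<integral>t. indicator {0<..<1} t *\<^sub>R ext_Beta_integrand \<nu> y x p t \<partial>lborel) =
      (LBINT t=0..1. ext_Beta_integrand \<nu> y x p t)"
    by (simp add: interval_lebesgue_integral_def einterval_0_1 set_lebesgue_integral_def)
  finally show ?thesis .
qed

section \<open>The three changes of variable\<close>

lemma ext_Beta_conv_integrand:
  "ext_Beta \<nu> x y p = csqrt (2 * p / of_real pi) * (LBINT t=0..1. ext_Beta_integrand \<nu> x y p t)"
  by (simp add: ext_Beta_def ext_Beta_integrand_def)

text \<open>Put \<open>u = 2 * t - 1\<close>: the two powers and the derivative contribute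
  \<open>2 powr (x - 3/2)\<close>, \<open>2 powr (y - 3/2)\<close> and 2.\<close>

lemma ext_Beta_symmetric_interval:
  fixes x y \<nu> p :: complex
  assumes p: "Re p > 0"
  defines "f \<equiv> (\<lambda>u::real. of_real (1 + u) powr (x - 3/2) * of_real (1 - u) powr (y - 3/2) *
                bessel_K (\<nu> + 1/2) (4 * p / of_real (1 - u\<^sup>2)))"
  shows "interval_lebesgue_integrable lborel (-1) 1 f"
    and "(LBINT u=-1..1. f u) = 2 powr (x + y - 2) * (LBINT t=0..1. ext_Beta_integrand \<nu> x y p t)"
proof -
  let ?h = "\<lambda>t. 2 powr (x + y - 2) * ext_Beta_integrand \<nu> x y p t"
  have einterval: "einterval (-1) 1 = {-1<..<1}"
    by (auto simp: einterval_def one_ereal_def)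
  have "continuous_on {-1<..<1} (\<lambda>u. bessel_K (\<nu> + 1/2) (p * of_real (4 / (1 - u\<^sup>2))))"
    by (intro continuous_on_bessel_K_ray[OF p] continuous_intros)
       (auto simp: power2_eq_1_iff abs_square_less_1)
  hence contf: "continuous_on (einterval (-1) 1) f"
    unfolding f_def einterval
    by (intro continuous_on_mult continuous_on_of_real_powr continuous_intros) (auto simp: mult.commute)
  have eq: "2 *\<^sub>R f (2 * t - 1) = ?h t" if "0 < ereal t" "ereal t < 1" for t
  proof -
    have t: "t > 0" "1 - t > 0" using that by (simp_all add: zero_ereal_def one_ereal_def)
    have 1: "complex_of_real (1 + (2 * t - 1)) powr (x - 3/2) = 2 powr (x - 3/2) * of_real t powr (x - 3/2)"
      using t powr_times_real[of "2::complex" "of_real t" "x - 3/2"] by simp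
    have "1 - (2 * t - 1) = 2 * (1 - t)" by simp
    hence 2: "complex_of_real (1 - (2 * t - 1)) powr (y - 3/2) = 2 powr (y - 3/2) * of_real (1 - t) powr (y - 3/2)"
      using t powr_times_real[of "2::complex" "of_real (1 - t)" "y - 3/2"] by simp
    have "1 - (2 * t - 1)\<^sup>2 = 4 * (t * (1 - t))" by (simp add: power2_eq_square algebra_simps)
    hence 3: "4 * p / complex_of_real (1 - (2 * t - 1)\<^sup>2) = p / of_real (t * (1 - t))"
      by (simp only: of_real_mult[of 4]) simp
    have "(2::complex) powr (x + y - 2) = 2 powr (1 + (x - 3/2) + (y - 3/2))" by (simp add: algebra_simps)
    also have "\<dots> = 2 * 2 powr (x - 3/2) * 2 powr (y - 3/2)" by (simp only: powr_add) simp
    finally have 4: "(2::complex) powr (x + y - 2) = 2 * 2 powr (x - 3/2) * 2 powr (y - 3/2)" .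
    show ?thesis unfolding f_def ext_Beta_integrand_def 1 2 3 4
      by (simp only: scaleR_conv_of_real of_real_numeral mult_ac)
  qed
  have int: "set_integrable lborel (einterval 0 1) ?h"
    by (intro set_integrable_mult_right ext_Beta_integrand_integrable p)
  have "((\<lambda>t::real. 2 * t - 1) \<longlongrightarrow> -1) (at_right 0)" by real_asymp
  hence A: "((ereal \<circ> (\<lambda>t. 2 * t - 1) \<circ> real_of_ereal) \<longlongrightarrow> -1) (at_right 0)"
    unfolding zero_ereal_def one_ereal_def uminus_ereal.simps by (simp only: ereal_tendsto_simps)
  have "((\<lambda>t::real. 2 * t - 1) \<longlongrightarrow> 1) (at_left 1)" by real_asymp
  hence B: "((ereal \<circ> (\<lambda>t. 2 * t - 1) \<circ> real_of_ereal) \<longlongrightarrow> 1) (at_left 1)"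
    unfolding zero_ereal_def one_ereal_def uminus_ereal.simps by (simp only: ereal_tendsto_simps)
  have range: "2 * t - 1 \<in> einterval (-1) 1" if "0 < ereal t" "ereal t < 1" for t
    using that by (auto simp: einterval zero_ereal_def one_ereal_def)
  have deriv: "DERIV (\<lambda>t. 2 * t - 1) t :> 2" for t :: real
    by (auto intro!: derivative_eq_intros)
  note subst = interval_integral_substitution_complex[OF _ _ deriv range contf _ _ A B eq int]
  show "interval_lebesgue_integrable lborel (-1) 1 f" by (rule subst) (auto simp: one_ereal_def)
  have "(LBINT u=-1..1. f u) = (LBINT t=0..1. ?h t)" by (rule subst) (auto simp: one_ereal_def)
  thus "(LBINT u=-1..1. f u) = 2 powr (x + y - 2) * (LBINT t=0..1. ext_Beta_integrand \<nu> x y p t)"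
    by simp
qed

text \<open>Put \<open>u = t / (1 - t)\<close>; then \<open>1 + u = 1 / (1 - t)\<close> and
  \<open>2 + u + 1 / u = 1 / (t * (1 - t))\<close>.\<close>

lemma ext_Beta_half_line:
  fixes x y \<nu> p :: complex
  assumes p: "Re p > 0"
  defines "f \<equiv> (\<lambda>u::real. of_real u powr (x - 3/2) / of_real (1 + u) powr (x + y - 1) *
                bessel_K (\<nu> + 1/2) (p * of_real (2 + u + 1 / u)))"
  shows "interval_lebesgue_integrable lborel 0 \<infinity> f"
    and "(LBINT u=0..\<infinity>. f u) = (LBINT t=0..1. ext_Beta_integrand \<nu> x y p t)"
proof -
  let ?h = "ext_Beta_integrand \<nu> x y p"
  have einterval: "einterval 0 \<infinity> = {0<..}"
    by (auto simp: einterval_def zero_ereal_def)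
  have "continuous_on {0<..} (\<lambda>u. bessel_K (\<nu> + 1/2) (p * of_real (2 + u + 1 / u)))"
    by (intro continuous_on_bessel_K_ray[OF p] continuous_intros) (auto intro!: add_pos_pos)
  hence contf: "continuous_on (einterval 0 \<infinity>) f"
    unfolding f_def einterval
    by (intro continuous_on_mult continuous_on_divide continuous_on_of_real_powr continuous_intros)
       (auto simp del: of_real_add)
  have eq: "(1 / (1 - t)\<^sup>2) *\<^sub>R f (t / (1 - t)) = ?h t" if "0 < ereal t" "ereal t < 1" for t
  proof -
    have t: "t > 0" "1 - t > 0" using that by (simp_all add: zero_ereal_def one_ereal_def)
    let ?c = "complex_of_real (1 - t)"
    have c: "?c \<noteq> 0" using t by (simp del: of_real_diff)
    have inv: "complex_of_real (1 / (1 - t)) powr w = ?c powr (-w)" for w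
      using t by (simp add: powr_def Ln_of_real exp_minus ln_div ln_inverse del: of_real_diff flip: of_real_divide)
    have 1: "complex_of_real (t / (1 - t)) powr (x - 3/2) = of_real t powr (x - 3/2) * ?c powr (- (x - 3/2))"
      using t powr_times_real[of "complex_of_real t" "of_real (1 / (1 - t))" "x - 3/2"] unfolding inv by simp
    have "1 + t / (1 - t) = 1 / (1 - t)" using t by (simp add: field_simps)
    hence 2: "complex_of_real (1 + t / (1 - t)) powr (x + y - 1) = ?c powr (- (x + y - 1))"
      by (simp only: inv)
    have "2 + t / (1 - t) + 1 / (t / (1 - t)) = 1 / (t * (1 - t))" using t by (simp add: field_simps)
    hence 3: "p * complex_of_real (2 + t / (1 - t) + 1 / (t / (1 - t))) = p / of_real (t * (1 - t))"
      by (simp only:) simp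
    \<comment> \<open>Exponents of \<open>1 - t\<close>: \<open>- (x - 3/2)\<close> from the
      numerator, \<open>x + y - 1\<close> from the denominator, -2 from the derivative.\<close>
    have "?c powr (y - 3/2) = ?c powr (- (x - 3/2) - (- (x + y - 1)) - of_nat 2)" by (simp add: algebra_simps)
    also have "\<dots> = ?c powr (- (x - 3/2)) / ?c powr (- (x + y - 1)) / ?c ^ 2"
      using c by (simp only: powr_diff powr_nat' simp_thms)
    finally have 4: "?c powr (y - 3/2) = ?c powr (- (x - 3/2)) / ?c powr (- (x + y - 1)) / ?c ^ 2" .
    show ?thesis unfolding f_def ext_Beta_integrand_def 1 2 3 4
      by (simp add: scaleR_conv_of_real)
  qed
  have "((\<lambda>t::real. t / (1 - t)) \<longlongrightarrow> 0) (at_right 0)" by real_asymp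
  hence A: "((ereal \<circ> (\<lambda>t. t / (1 - t)) \<circ> real_of_ereal) \<longlongrightarrow> 0) (at_right 0)"
    unfolding zero_ereal_def one_ereal_def uminus_ereal.simps by (simp only: ereal_tendsto_simps)
  have "filterlim (\<lambda>t::real. t / (1 - t)) at_top (at_left 1)" by real_asymp
  hence B: "((ereal \<circ> (\<lambda>t. t / (1 - t)) \<circ> real_of_ereal) \<longlongrightarrow> \<infinity>) (at_left 1)"
    unfolding one_ereal_def by (simp only: ereal_tendsto_simps)
  have range: "t / (1 - t) \<in> einterval 0 \<infinity>" if "0 < ereal t" "ereal t < 1" for t
    using that by (auto simp: einterval zero_ereal_def one_ereal_def)
  have deriv: "DERIV (\<lambda>t. t / (1 - t)) t :> 1 / (1 - t)\<^sup>2" if "0 < ereal t" "ereal t < 1" for t :: real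
    using that by (auto intro!: derivative_eq_intros simp: one_ereal_def power2_eq_square field_simps)
  have cont: "isCont (\<lambda>t::real. 1 / (1 - t)\<^sup>2) t" if "0 < ereal t" "ereal t < 1" for t
    using that by (intro continuous_intros) (auto simp: one_ereal_def)
  note subst = interval_integral_substitution_complex[OF _ _ deriv range contf cont _ A B eq
    ext_Beta_integrand_integrable[OF p]]
  show "interval_lebesgue_integrable lborel 0 \<infinity> f" by (rule subst) auto
  show "(LBINT u=0..\<infinity>. f u) = (LBINT t=0..1. ?h t)" by (rule subst) auto
qed

text \<open>The substitution is \<open>t = sin\<close> squared rather than \<open>cos\<close>
  squared, because its inverse \<open>arcsin (sqrt t)\<close> is increasing as the substitution rule
  demands. Hence \<open>x\<close> and \<open>y\<close> are exchanged in \<open>?h\<close>, which the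
  reflection undoes.\<close>

lemma ext_Beta_trigonometric:
  fixes x y \<nu> p :: complex
  assumes p: "Re p > 0"
  defines "f \<equiv> (\<lambda>\<theta>::real. of_real (cos \<theta>) powr (2 * (x - 1)) * of_real (sin \<theta>) powr (2 * (y - 1)) *
                bessel_K (\<nu> + 1/2) (p * of_real ((1 / cos \<theta>)\<^sup>2 * (1 / sin \<theta>)\<^sup>2)))"
  shows "interval_lebesgue_integrable lborel 0 (ereal (pi / 2)) f"
    and "2 * (LBINT \<theta>=0..ereal (pi / 2). f \<theta>) = (LBINT t=0..1. ext_Beta_integrand \<nu> x y p t)"
proof -
  let ?h = "\<lambda>t. (1/2) * ext_Beta_integrand \<nu> y x p t"
  let ?g = "\<lambda>t. arcsin (sqrt t)" and ?g' = "\<lambda>t. 1 / (2 * sqrt t * sqrt (1 - t))"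
  have einterval: "einterval 0 (ereal (pi / 2)) = {0<..<pi/2}"
    by (auto simp: einterval_def zero_ereal_def)
  have pos: "cos \<theta> > 0" "sin \<theta> > 0" if "\<theta> \<in> {0<..<pi/2}" for \<theta>
    using that by (auto intro: cos_gt_zero sin_gt_zero2)
  have "continuous_on {0<..<pi/2} (\<lambda>\<theta>. bessel_K (\<nu> + 1/2) (p * of_real ((1 / cos \<theta>)\<^sup>2 * (1 / sin \<theta>)\<^sup>2)))"
    using pos by (intro continuous_on_bessel_K_ray[OF p] continuous_intros) (force intro!: mult_pos_pos)+
  hence contf: "continuous_on (einterval 0 (ereal (pi / 2))) f"
    unfolding f_def einterval using pos
    by (intro continuous_on_mult continuous_on_of_real_powr continuous_intros) auto
  have eq: "?g' t *\<^sub>R f (?g t) = ?h t" if "0 < ereal t" "ereal t < 1" for t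
  proof -
    have t: "t > 0" "1 - t > 0" using that by (simp_all add: zero_ereal_def one_ereal_def)
    have s: "sin (?g t) = sqrt t" using t by (intro sin_arcsin) (auto intro: order_trans[of _ 0])
    have co: "cos (?g t) = sqrt (1 - t)" using t by (subst cos_arcsin) (auto intro: order_trans[of _ 0])
    \<comment> \<open>One factor \<open>sqrt r\<close> is split off to cancel against the
      denominator of \<open>?g'\<close>.\<close>
    have root: "complex_of_real (sqrt r) powr (2 * (w - 1)) = of_real (sqrt r) * of_real r powr (w - 3/2)"
      if "r > 0" for r w
    proof -
      have "complex_of_real (sqrt r) powr (2 * (w - 1)) = of_real (sqrt r) powr (1 + ((w - 3/2) + (w - 3/2)))"
        by (simp add: algebra_simps)
      also have "\<dots> = of_real (sqrt r) * (of_real (sqrt r) powr (w - 3/2) * of_real (sqrt r) powr (w - 3/2))"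
        using that by (simp only: powr_add) simp
      also have "of_real (sqrt r) powr (w - 3/2) * of_real (sqrt r) powr (w - 3/2) = complex_of_real (sqrt r * sqrt r) powr (w - 3/2)"
        using that powr_times_real[of "complex_of_real (sqrt r)" "of_real (sqrt r)" "w - 3/2"]
        by (simp only: of_real_mult) simp
      also have "sqrt r * sqrt r = r" using that by simp
      finally show ?thesis .
    qed
    have "(1 / sqrt (1 - t))\<^sup>2 * (1 / sqrt t)\<^sup>2 = 1 / (t * (1 - t))"
      using t by (simp add: power_divide)
    hence 3: "p * complex_of_real ((1 / sqrt (1 - t))\<^sup>2 * (1 / sqrt t)\<^sup>2) = p / of_real (t * (1 - t))"
      by (simp only:) simp
    have nz: "complex_of_real (sqrt t) \<noteq> 0" "complex_of_real (sqrt (1 - t)) \<noteq> 0" using t by auto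
    show ?thesis unfolding f_def ext_Beta_integrand_def s co root[OF t(1)] root[OF t(2)] 3
      using nz by (simp add: scaleR_conv_of_real del: of_real_diff)
  qed
  have int: "set_integrable lborel (einterval 0 1) ?h"
    by (intro set_integrable_mult_right ext_Beta_integrand_integrable p)
  have cont: "continuous_on {0..1} ?g" by (intro continuous_intros) (auto intro: order_trans[of _ 0])
  have "(?g \<longlongrightarrow> 0) (at_right 0)"
    using cont by (auto simp: continuous_on_def at_within_Icc_at_right dest: bspec[of _ _ 0])
  hence A: "((ereal \<circ> ?g \<circ> real_of_ereal) \<longlongrightarrow> 0) (at_right 0)"
    unfolding zero_ereal_def by (simp only: ereal_tendsto_simps)
  have "(?g \<longlongrightarrow> pi / 2) (at_left 1)"
    using cont by (auto simp: continuous_on_def at_within_Icc_at_left dest: bspec[of _ _ 1])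
  hence B: "((ereal \<circ> ?g \<circ> real_of_ereal) \<longlongrightarrow> ereal (pi / 2)) (at_left 1)"
    unfolding one_ereal_def by (simp only: ereal_tendsto_simps)
  have range: "?g t \<in> einterval 0 (ereal (pi / 2))" if "0 < ereal t" "ereal t < 1" for t
  proof -
    have t: "t > 0" "t < 1" using that by (simp_all add: zero_ereal_def one_ereal_def)
    have "arcsin 0 < ?g t" using t by (intro arcsin_less_arcsin) auto
    moreover have "?g t < arcsin 1" using t by (intro arcsin_less_arcsin) (auto intro: order_trans[of _ 0])
    ultimately show ?thesis by (simp add: einterval)
  qed
  have deriv: "DERIV ?g t :> ?g' t" if "0 < ereal t" "ereal t < 1" for t
  proof -
    have t: "t > 0" "t < 1" using that by (simp_all add: zero_ereal_def one_ereal_def)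
    hence "-1 < sqrt t" by (meson less_trans neg_less_0_iff_less real_sqrt_gt_zero zero_less_one)
    thus ?thesis using t by (auto intro!: derivative_eq_intros simp: field_simps)
  qed
  have cont': "isCont ?g' t" if "0 < ereal t" "ereal t < 1" for t
    using that by (intro continuous_intros) (auto simp: one_ereal_def zero_ereal_def)
  \<comment> \<open>At 0 and 1 the quotient has a zero denominator and takes the default value
    0.\<close>
  have nonneg: "?g' t \<ge> 0" if "0 \<le> ereal t" "ereal t \<le> 1" for t
    using that by (auto simp: one_ereal_def zero_ereal_def)
  note subst = interval_integral_substitution_complex[OF _ _ deriv range contf cont' nonneg A B eq int]
  show "interval_lebesgue_integrable lborel 0 (ereal (pi / 2)) f" by (rule subst) auto
  have "(LBINT \<theta>=0..ereal (pi / 2). f \<theta>) = (LBINT t=0..1. ?h t)" by (rule subst) auto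
  thus "2 * (LBINT \<theta>=0..ereal (pi / 2). f \<theta>) = (LBINT t=0..1. ext_Beta_integrand \<nu> x y p t)"
    by (simp add: ext_Beta_integrand_integral_commute[of \<nu> x y] mult.commute)
qed

theorem theorem1:
  fixes x y \<nu> p :: complex
  assumes "Re p > 0"
  shows "(let f = (\<lambda>\<theta>::real. of_real (cos \<theta>) powr (2 * (x - 1)) * of_real (sin \<theta>) powr (2 * (y - 1)) *
                bessel_K (\<nu> + 1/2) (p * of_real ((1 / cos \<theta>)\<^sup>2 * (1 / sin \<theta>)\<^sup>2)))
          in interval_lebesgue_integrable lborel 0 (ereal (pi / 2)) f \<and>
             ext_Beta \<nu> x y p =
               2 * csqrt (2 * p / of_real pi) * (LBINT \<theta>=0..ereal (pi / 2). f \<theta>)) \<and>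
         (let f = (\<lambda>u::real. of_real u powr (x - 3/2) / of_real (1 + u) powr (x + y - 1) *
                bessel_K (\<nu> + 1/2) (p * of_real (2 + u + 1 / u)))
          in interval_lebesgue_integrable lborel 0 \<infinity> f \<and>
             ext_Beta \<nu> x y p =
               csqrt (2 * p / of_real pi) * (LBINT u=0..\<infinity>. f u)) \<and>
         (let f = (\<lambda>u::real. of_real (1 + u) powr (x - 3/2) * of_real (1 - u) powr (y - 3/2) *
                bessel_K (\<nu> + 1/2) (4 * p / of_real (1 - u\<^sup>2)))
          in interval_lebesgue_integrable lborel (-1) 1 f \<and>
             ext_Beta \<nu> x y p =
               2 powr (2 - x - y) * csqrt (2 * p / of_real pi) * (LBINT u=-1..1. f u))"
proof -
  \<comment> \<open>The prefactor of the third formula cancels the power of 2 produced by its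
    substitution.\<close>
  have "(2::complex) powr (2 - x - y) * 2 powr (x + y - 2) = 1"
    by (simp flip: powr_add)
  hence *: "2 powr (2 - x - y) * c * (2 powr (x + y - 2) * I) = c * I" for c I :: complex
    by (metis mult.assoc mult.commute mult.left_neutral)
  show ?thesis
    unfolding Let_def ext_Beta_conv_integrand
    using ext_Beta_trigonometric[OF assms, of x y \<nu>] ext_Beta_half_line[OF assms, of x y \<nu>]
      ext_Beta_symmetric_interval[OF assms, of x y \<nu>]
    by (simp only: *) (simp flip: ext_Beta_trigonometric(2)[OF assms, of x y \<nu>])
qed

end
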